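(* Let $\Omega\subset\mathbb{R}^d$ be a bounded domain, $\mathtt{U}_{\rm in}\in L^\infty(\Omega;\mathbb{R}^2)$, and $\mathtt{A}=\begin{pmatrix}0&1\\-1&0\end{pmatrix}$. Let $\{b^\varepsilon\}_{\varepsilon>0}$ be a family of measurable real-valued functions on $\Omega$ such that $$-\infty<b_{\min}\le b^\varepsilon(x)\le b_{\max}<\infty$$ uniformly in $\varepsilon$ and in $x\in\Omega$, and let $\{\nu_x\}_{x\in\Omega}$ be the family of Young measures associated with $b^\varepsilon$. Let $\mathtt{U}^\varepsilon:[0,\infty)\times\Omega\to\mathbb{R}^2$ be the solution of $$\partial_t\mathtt{U}^\varepsilon(t,x)=b^\varepsilon(x)\,\mathtt{A}\,\mathtt{U}^\varepsilon(t,x)\quad\text{for }t>0,\ x\in\Omega,\qquad \mathtt{U}^\varepsilon(0,x)=\mathtt{U}_{\rm in}(x)\quad\text{for }x\in\Omega.$$ Then $$\mathtt{U}^\varepsilon\rightharpoonup\mathtt{U}^0\quad\text{weakly}\ast\text{ in }L^\infty,$$ with the limit $\mathtt{U}^0$ satisfying the integro-differential system $$\partial_t\mathtt{U}^0(t,x)-b^\ast(x)\,\mathtt{A}\,\mathtt{U}^0(t,x)=\int_0^t\mathbb{K}(x,t-s)\,\mathtt{U}^0(s,x)\,ds\quad\text{for }t>0,\ x\in\Omega,\qquad \mathtt{U}^0(0,x)=\mathtt{U}_{\rm in}(x)\quad\text{for }x\in\Omega,$$ where $b^\ast(x):=\int_{b_{\min}}^{b_{\max}}\lambda\,d\nu_x(\lambda)$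 and where the memory kernel $\mathbb{K}$ is characterised by its Laplace transform in the time variable: $$\widehat{\mathbb{K}}(p,x)=p\,{\rm Id}-b^\ast(x)\,\mathtt{A}-\mathtt{B}(p,x)\quad\text{for }p>0,\ x\in\Omega,$$ with $$\mathtt{B}(p,x):=\left(\int_{b_{\min}}^{b_{\max}}\frac{1}{p^2+\lambda^2}\begin{pmatrix}p&\lambda\\-\lambda&p\end{pmatrix}d\nu_x(\lambda)\right)^{-1}.$$
   Context: The Laplace transform in time of a function $h$ is $\widehat{h}(p):=\int_0^\infty e^{-ps}h(s)\,ds$, $p>0$. "Weakly $\ast$ in $L^\infty$" refers to $L^\infty((0,\infty)\times\Omega;\mathbb{R}^2)$. The Young measures associated with $b^\varepsilon$ are probability measures $\nu_x$ supported in $[b_{\min},b_{\max}]$ such that for every $\mathcal{G}\in C(\mathbb{R})$, $\mathcal{G}(b^\varepsilon)\rightharpoonup\int_{b_{\min}}^{b_{\max}}\mathcal{G}(\lambda)\,d\nu_x(\lambda)$ weakly $\ast$ in $L^\infty(\Omega)$ as $\varepsilon\to0$. Such measures exist after extraction of a subsequence of $b^\varepsilon$; as usual, this subsequence is still denoted $b^\varepsilon$, and the convergence of $\mathtt{U}^\varepsilon$ is along it. *)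

theory Defs
  imports "HOL-Probability.Probability"
begin

definition in_Linfty :: "'a measure \<Rightarrow> ('a \<Rightarrow> 'b::euclidean_space) \<Rightarrow> bool" where
  "in_Linfty M f \<longleftrightarrow> f \<in> borel_measurable M \<and> (\<exists>C. AE x in M. norm (f x) \<le> C)"

text \<open>Weak-star convergence, tested against integrable \<open>\<phi>\<close>; for real-valued functions the
  inner product is multiplication.\<close>

definition weak_star_Linfty ::
  "'a measure \<Rightarrow> (nat \<Rightarrow> 'a \<Rightarrow> 'b::euclidean_space) \<Rightarrow> ('a \<Rightarrow> 'b) \<Rightarrow> bool" where
  "weak_star_Linfty M f g \<longleftrightarrow>
     (\<forall>n. in_Linfty M (f n)) \<and> in_Linfty M g \<and>
     (\<forall>\<phi>::'a \<Rightarrow> 'b. integrable M \<phi> \<longrightarrow>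
        (\<lambda>n. \<integral>x. f n x \<bullet> \<phi> x \<partial>M) \<longlonglongrightarrow> (\<integral>x. g x \<bullet> \<phi> x \<partial>M))"

definition young_measures ::
  "(real ^ 'd) set \<Rightarrow> real \<Rightarrow> real \<Rightarrow> (nat \<Rightarrow> real ^ 'd \<Rightarrow> real) \<Rightarrow>
     (real ^ 'd \<Rightarrow> real measure) \<Rightarrow> bool" where
  "young_measures \<Omega> bmin bmax b \<nu> \<longleftrightarrow>
     (\<forall>x\<in>\<Omega>. prob_space (\<nu> x) \<and> sets (\<nu> x) = sets borel \<and>
        emeasure (\<nu> x) (- {bmin..bmax}) = 0) \<and>
     (\<forall>G::real \<Rightarrow> real. continuous_on UNIV G \<longrightarrow>
        weak_star_Linfty (lebesgue_on \<Omega>) (\<lambda>n x. G (b n x))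
          (\<lambda>x. LINT y:{bmin..bmax}|\<nu> x. G y))"

definition A_mat :: "real ^ 2 ^ 2" where
  "A_mat = vector [vector [0, 1], vector [- 1, 0]]"

text \<open>A representative that solves the system at every point of \<open>\<Omega>\<close>; the time derivative is
  required for positive times only, and continuity at time 0 makes the initial condition effective.\<close>

definition solves_oscillation ::
  "(real ^ 'd) set \<Rightarrow> (real ^ 'd \<Rightarrow> real) \<Rightarrow> (real ^ 'd \<Rightarrow> real ^ 2) \<Rightarrow>
     (real \<Rightarrow> real ^ 'd \<Rightarrow> real ^ 2) \<Rightarrow> bool" where
  "solves_oscillation \<Omega> b Uin U \<longleftrightarrow>
     (\<forall>x\<in>\<Omega>. U 0 x = Uin x \<and> continuous_on {0..} (\<lambda>t. U t x) \<and>
        (\<forall>t>0. ((\<lambda>s. U s x) has_vector_derivative b x *\<^sub>R (A_mat *v U t x)) (at t)))"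

definition solves_memory ::
  "(real ^ 'd) set \<Rightarrow> (real ^ 'd \<Rightarrow> real) \<Rightarrow> (real ^ 'd \<Rightarrow> real \<Rightarrow> real ^ 2 ^ 2) \<Rightarrow>
     (real ^ 'd \<Rightarrow> real ^ 2) \<Rightarrow> (real \<Rightarrow> real ^ 'd \<Rightarrow> real ^ 2) \<Rightarrow> bool" where
  "solves_memory \<Omega> b K Uin U \<longleftrightarrow>
     (\<forall>x\<in>\<Omega>. U 0 x = Uin x \<and> continuous_on {0..} (\<lambda>t. U t x) \<and>
        (\<forall>t>0. (\<lambda>s. U s x) differentiable (at t) \<and>
           set_integrable lebesgue {0..t} (\<lambda>s. K x (t - s) *v U s x) \<and>
           vector_derivative (\<lambda>s. U s x) (at t) - b x *\<^sub>R (A_mat *v U t x)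
             = (LINT s:{0..t}|lebesgue. K x (t - s) *v U s x)))"

text \<open>\<open>has_laplace h p L\<close>: the Laplace integral of \<open>h\<close> at \<open>p\<close> converges absolutely and equals
  \<open>L\<close>.\<close>

definition has_laplace :: "(real \<Rightarrow> 'b::euclidean_space) \<Rightarrow> real \<Rightarrow> 'b \<Rightarrow> bool" where
  "has_laplace h p L \<longleftrightarrow>
     set_integrable lebesgue {0..} (\<lambda>s. exp (- p * s) *\<^sub>R h s) \<and>
     (LINT s:{0..}|lebesgue. exp (- p * s) *\<^sub>R h s) = L"

definition b_star :: "real \<Rightarrow> real \<Rightarrow> (real ^ 'd \<Rightarrow> real measure) \<Rightarrow> real ^ 'd \<Rightarrow> real" where
  "b_star bmin bmax \<nu> x = (LINT y:{bmin..bmax}|\<nu> x. y)"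

definition resolvent_mean ::
  "real \<Rightarrow> real \<Rightarrow> (real ^ 'd \<Rightarrow> real measure) \<Rightarrow> real \<Rightarrow> real ^ 'd \<Rightarrow> real ^ 2 ^ 2" where
  "resolvent_mean bmin bmax \<nu> p x =
     (LINT y:{bmin..bmax}|\<nu> x.
        (1 / (p\<^sup>2 + y\<^sup>2)) *\<^sub>R (vector [vector [p, y], vector [- y, p]] :: real ^ 2 ^ 2))"

definition B_mat ::
  "real \<Rightarrow> real \<Rightarrow> (real ^ 'd \<Rightarrow> real measure) \<Rightarrow> real \<Rightarrow> real ^ 'd \<Rightarrow> real ^ 2 ^ 2" where
  "B_mat bmin bmax \<nu> p x = matrix_inv (resolvent_mean bmin bmax \<nu> p x)"

definition kernel_laplace ::
  "real \<Rightarrow> real \<Rightarrow> (real ^ 'd \<Rightarrow> real measure) \<Rightarrow> real \<Rightarrow> real ^ 'd \<Rightarrow> real ^ 2 ^ 2" where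
  "kernel_laplace bmin bmax \<nu> p x =
     p *\<^sub>R mat 1 - b_star bmin bmax \<nu> x *\<^sub>R A_mat - B_mat bmin bmax \<nu> p x"

end

theory Submission
  imports Defs
begin

text \<open>The matrix \<open>A\<close> squares to \<open>-1\<close>, so \<open>a I + b A\<close> multiplies like the complex number \<open>a + i b\<close>. All the
  matrices of the problem are images of complex numbers under this identification (\<open>complex_mat\<close>),
  and the two systems become scalar complex equations.

  For fixed \<open>x\<close> the oscillating solution is \<open>exp (i t b(x))\<close> acting on the initial datum. Its entries
  are continuous functions of \<open>b(x)\<close>, so at each time the Young measures produce the weak-star limit:
  the characteristic function of \<open>\<nu>\<^sub>x\<close> at \<open>t\<close>, acting on the datum. Fubini and dominated convergence in
  time turn convergence at each time into convergence on space-time (\<open>weak_star_Linfty_Times\<close>).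

  What remains concerns a single probability law \<open>\<mu>\<close> with compact support and its characteristic
  function \<open>\<phi>\<close>: there must be a kernel \<open>k\<close> with \<open>\<phi>' - i m \<phi> = k * \<phi>\<close>, where \<open>m\<close> is the mean, whose Laplace
  integral converges absolutely for every \<open>p > 0\<close>. Solving the Volterra equation for \<open>k\<close> only gives an
  exponential bound, hence convergence for large \<open>p\<close>. Instead \<open>k\<close> is written down by the projection
  method of Mori and Zwanzig. On the space of square-integrable functions of \<open>y\<close> let \<open>Q\<close> be the
  projection onto mean-zero functions and let \<open>L\<close> be multiplication by \<open>y\<close> followed by \<open>Q\<close>. Put
  \<open>u(t) = exp (i t L) (y - m)\<close> (\<open>evol\<close>) and let \<open>k(t)\<close> be minus the mean of \<open>y u(t)\<close> (\<open>memory\<close>). Then \<open>u\<close> has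
  mean zero and \<open>u' = i (y u + k)\<close>, and everything follows by differentiating means of \<open>u\<close>:

  \<^item> \<open>L\<close> is symmetric on mean-zero functions, so the mean of \<open>|u|\<^sup>2\<close> is conserved and \<open>k\<close> is bounded
    (\<open>norm_memory_le_const\<close>);
  \<^item> the mean of \<open>exp (i s y) u(t - s)\<close> has \<open>s\<close>-derivative \<open>-i k(t - s) \<phi>(s)\<close>, and integrating over \<open>[0, t]\<close>
    is the memory equation (\<open>memory_equation\<close>);
  \<^item> the mean of \<open>exp (- p s) u(s) / (p - i y)\<close> has derivative \<open>i F(p) exp (- p s) k(s)\<close>, where \<open>F(p)\<close> is the
    mean of \<open>1 / (p - i y)\<close>; integrating over \<open>[0, \<infinity>)\<close> gives \<open>p - i m - 1 / F(p)\<close> as the transform of \<open>k\<close>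
    (\<open>laplace_memory\<close>).

  The real part of \<open>F(p)\<close> is positive, which gives the invertibility of the averaged resolvent. The
  kernel is determined by its transform because, after substituting \<open>exp (- s)\<close> for the variable, the
  values of a Laplace transform at the positive integers are the moments of a function on the unit
  interval, and these determine it by the Weierstrass approximation theorem.\<close>

section \<open>Differentiation under the integral sign\<close>

lemma has_vector_derivative_iff_quotient_tendsto:
  fixes f :: "real \<Rightarrow> 'b::real_normed_vector"
  shows "(f has_vector_derivative D) (at t) \<longleftrightarrow> ((\<lambda>h. (f (t + h) - f t) /\<^sub>R h) \<longlongrightarrow> D) (at 0)"
proof -
  have "((\<lambda>h. norm (f (t + h) - f t - h *\<^sub>R D) / norm h) \<longlongrightarrow> 0) (at 0)
      \<longleftrightarrow> ((\<lambda>h. norm ((f (t + h) - f t) /\<^sub>R h - D)) \<longlongrightarrow> 0) (at 0)"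
  proof (rule Lim_cong_within)
    fix h :: real assume "h \<noteq> 0"
    then have "(f (t + h) - f t) /\<^sub>R h - D = (f (t + h) - f t - h *\<^sub>R D) /\<^sub>R h"
      by (simp add: scaleR_diff_right)
    then show "norm (f (t + h) - f t - h *\<^sub>R D) / norm h = norm ((f (t + h) - f t) /\<^sub>R h - D)"
      by (simp add: divide_inverse mult.commute)
  qed auto
  then show ?thesis
    by (simp add: has_vector_derivative_def has_derivative_at bounded_linear_scaleR_left
        tendsto_norm_zero_iff LIM_zero_iff)
qed

text \<open>Dominated convergence of difference quotients: by the mean value inequality they are bounded by
  any bound of the derivative that is uniform in the integration variable and locally uniform in the
  parameter.\<close>

lemma (in finite_measure) has_vector_derivative_integral:
  fixes f f' :: "real \<Rightarrow> 'a \<Rightarrow> 'b::{banach, second_countable_topology}"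
  assumes int: "\<And>t. integrable M (f t)"
    and meas: "\<And>t. f' t \<in> borel_measurable M"
    and der: "AE x in M. \<forall>t. ((\<lambda>s. f s x) has_vector_derivative f' t x) (at t)"
    and bd: "\<And>T. \<exists>C. AE x in M. \<forall>t. \<bar>t\<bar> \<le> T \<longrightarrow> norm (f' t x) \<le> C"
  shows "((\<lambda>t. \<integral>x. f t x \<partial>M) has_vector_derivative (\<integral>x. f' t x \<partial>M)) (at t)"
proof -
  have "((\<lambda>h. ((\<integral>x. f (t + h) x \<partial>M) - (\<integral>x. f t x \<partial>M)) /\<^sub>R h) \<longlongrightarrow> (\<integral>x. f' t x \<partial>M)) (at 0)"
    unfolding tendsto_at_iff_sequentially comp_def
  proof safe
    fix X :: "nat \<Rightarrow> real"
    assume X0: "\<forall>i. X i \<in> UNIV - {0}" and X: "X \<longlonglongrightarrow> 0"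
    from X have "Bseq X" using convergentI convergent_imp_Bseq by blast
    then obtain B where B: "\<And>i. \<bar>X i\<bar> \<le> B"
      by (elim BseqE) (metis real_norm_def)
    \<comment> \<open>All points between t and t + X i have absolute value at most abs t + B.\<close>
    obtain C where C: "AE x in M. \<forall>s. \<bar>s\<bar> \<le> \<bar>t\<bar> + B \<longrightarrow> norm (f' s x) \<le> C"
      using bd by blast
    have "(\<lambda>i. \<integral>x. (f (t + X i) x - f t x) /\<^sub>R X i \<partial>M) \<longlonglongrightarrow> (\<integral>x. f' t x \<partial>M)"
    proof (rule integral_dominated_convergence[where w = "\<lambda>_. C"])
      show "AE x in M. (\<lambda>i. (f (t + X i) x - f t x) /\<^sub>R X i) \<longlonglongrightarrow> f' t x"
        using der
      proof eventually_elim
        case (elim x)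
        then have "((\<lambda>h. (f (t + h) x - f t x) /\<^sub>R h) \<longlongrightarrow> f' t x) (at 0)"
          using has_vector_derivative_iff_quotient_tendsto[of "\<lambda>s. f s x"] by blast
        then show ?case
          unfolding tendsto_at_iff_sequentially comp_def using X0 X by blast
      qed
      show "AE x in M. norm ((f (t + X i) x - f t x) /\<^sub>R X i) \<le> C" for i
        using der C
      proof eventually_elim
        case (elim x)
        let ?I = "closed_segment t (t + X i)"
        have "norm (f (t + X i) x - f t x) \<le> C * norm (t + X i - t)"
        proof (rule differentiable_bound[where S = ?I and f' = "\<lambda>s h. h *\<^sub>R f' s x"])
          fix s assume s: "s \<in> ?I"
          show "((\<lambda>s. f s x) has_derivative (\<lambda>h. h *\<^sub>R f' s x)) (at s within ?I)"
            using elim has_vector_derivative_at_within unfolding has_vector_derivative_def[symmetric] by blast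
          have "\<bar>s\<bar> \<le> \<bar>t\<bar> + B"
            using s B[of i] by (auto simp: closed_segment_eq_real_ivl split: if_splits)
          then have "norm (f' s x) \<le> C" using elim by blast
          then show "onorm (\<lambda>h. h *\<^sub>R f' s x) \<le> C"
            by (intro onorm_le)
              (metis abs_ge_zero mult.commute mult_left_mono norm_scaleR real_norm_def)
        qed auto
        then show ?case using X0
          by (auto simp: divide_simps mult.commute)
      qed
    qed (use int meas in \<open>auto intro: borel_measurable_integrable\<close>)
    then show "(\<lambda>i. ((\<integral>x. f (t + X i) x \<partial>M) - (\<integral>x. f t x \<partial>M)) /\<^sub>R X i) \<longlonglongrightarrow> (\<integral>x. f' t x \<partial>M)"
      using int by simp
  qed
  then show ?thesis
    by (simp add: has_vector_derivative_iff_quotient_tendsto)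
qed

section \<open>The complex structure defined by the rotation generator\<close>

definition complex_mat :: "complex \<Rightarrow> real ^ 2 ^ 2" where
  "complex_mat z = Re z *\<^sub>R mat 1 + Im z *\<^sub>R A_mat"

lemma complex_mat_vector:
  "complex_mat z = vector [vector [Re z, Im z], vector [- Im z, Re z]]"
  by (simp add: complex_mat_def A_mat_def vec_eq_iff forall_2 mat_def)

lemma bounded_linear_complex_mat: "bounded_linear complex_mat"
  unfolding complex_mat_def
  by (intro bounded_linear_add bounded_linear_compose[OF bounded_linear_scaleR_left]
        bounded_linear_Re bounded_linear_Im)

lemma complex_mat_mult: "complex_mat (z * w) = complex_mat z ** complex_mat w"
  by (simp add: complex_mat_vector vec_eq_iff forall_2 matrix_matrix_mult_def sum_2 algebra_simps)

lemma complex_mat_1: "complex_mat 1 = mat 1"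
  and complex_mat_ii: "complex_mat \<i> = A_mat"
  by (simp_all add: complex_mat_def)

lemma complex_mat_inverse:
  assumes "z \<noteq> 0"
  shows "invertible (complex_mat z)" and "matrix_inv (complex_mat z) = complex_mat (inverse z)"
proof -
  have 1: "complex_mat z ** complex_mat (inverse z) = mat 1"
    "complex_mat (inverse z) ** complex_mat z = mat 1"
    using assms by (simp_all flip: complex_mat_mult add: complex_mat_1)
  then show inv: "invertible (complex_mat z)" unfolding invertible_def by blast
  have "matrix_inv (complex_mat z) = matrix_inv (complex_mat z) ** (complex_mat z ** complex_mat (inverse z))"
    by (simp add: 1)
  also have "\<dots> = complex_mat (inverse z)"
    using someI_ex[OF inv[unfolded invertible_def]]
    by (simp add: matrix_mul_assoc matrix_inv_def)
  finally show "matrix_inv (complex_mat z) = complex_mat (inverse z)" .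
qed

lemma complex_mat_mult_vec: "complex_mat z *v v = Re z *\<^sub>R v + Im z *\<^sub>R (A_mat *v v)"
  by (simp add: complex_mat_def matrix_vector_mult_add_rdistrib scaleR_matrix_vector_assoc[symmetric])

lemma bounded_linear_complex_mat_vec: "bounded_linear (\<lambda>z. complex_mat z *v v)"
  unfolding complex_mat_mult_vec
  by (intro bounded_linear_add bounded_linear_compose[OF bounded_linear_scaleR_left]
        bounded_linear_Re bounded_linear_Im)

lemma A_mat_mult_A_mat_vec: "A_mat *v (A_mat *v v) = - v"
  by (simp add: A_mat_def matrix_vector_mult_def vec_eq_iff forall_2 sum_2)

lemma norm_complex_mat_mult_vec: "norm (complex_mat z *v v) = norm z * norm v"
proof (rule power2_eq_imp_eq)
  show "(norm (complex_mat z *v v))\<^sup>2 = (norm z * norm v)\<^sup>2"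
    by (simp add: complex_mat_vector norm_vec_def L2_set_def sum_2 matrix_vector_mult_def
        cmod_power2 power_mult_distrib) (simp add: power2_eq_square algebra_simps)
qed auto

text \<open>Rotating the solution back by the angle \<open>t b(x)\<close> gives a function with zero derivative for positive
  times, which is constant because it is continuous up to time zero.\<close>

lemma solves_oscillation_unique:
  assumes sol: "solves_oscillation \<Omega> b Uin U" and x: "x \<in> \<Omega>" and t: "0 \<le> t"
  shows "U t x = complex_mat (iexp (t * b x)) *v Uin x"
proof -
  let ?c = "\<lambda>t. cos (t * b x)" and ?s = "\<lambda>t. sin (t * b x)"
  \<comment> \<open>w is the solution rotated back: the matrix of exp (- i t b(x)) applied to U.\<close>
  define w where "w t = ?c t *\<^sub>R U t x - ?s t *\<^sub>R (A_mat *v U t x)" for t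
  have U: "U 0 x = Uin x" "continuous_on {0..} (\<lambda>t. U t x)"
    "0 < t \<Longrightarrow> ((\<lambda>s. U s x) has_vector_derivative b x *\<^sub>R (A_mat *v U t x)) (at t)" for t
    using sol x unfolding solves_oscillation_def by auto
  have "w t = Uin x"
  proof (rule has_derivative_zero_unique_strong_interval[where k = "{0}" and a = 0 and b = t and f = w])
    show "continuous_on {0..t} w"
      unfolding w_def
      by (intro continuous_intros continuous_on_subset[OF U(2)]
          bounded_linear.continuous_on[OF matrix_vector_mul_bounded_linear]) auto
    show "w 0 = Uin x" by (simp add: w_def U(1))
    fix s assume "s \<in> {0..t} - {0}"
    then have s: "0 < s" by auto
    have c: "(?c has_field_derivative - b x * ?s s) (at s)" and d: "(?s has_field_derivative b x * ?c s) (at s)"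
      by (auto intro!: derivative_eq_intros)
    have AU: "((\<lambda>s. A_mat *v U s x) has_vector_derivative A_mat *v (b x *\<^sub>R (A_mat *v U s x))) (at s)"
      by (rule bounded_linear.has_vector_derivative[OF matrix_vector_mul_bounded_linear U(3)[OF s]])
    have "(w has_vector_derivative 0) (at s)"
      using has_vector_derivative_diff[OF has_vector_derivative_scaleR[OF c U(3)[OF s]]
          has_vector_derivative_scaleR[OF d AU]]
      by (simp add: w_def[abs_def] matrix_vector_mult_scaleR A_mat_mult_A_mat_vec algebra_simps)
    then show "(w has_derivative (\<lambda>h. 0)) (at s within {0..t})"
      unfolding has_vector_derivative_def by (simp add: has_derivative_at_withinI)
  qed (use t in auto)
  have "complex_mat (iexp (t * b x)) *v w t
      = ?c t *\<^sub>R w t + ?s t *\<^sub>R (A_mat *v w t)"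
    by (simp add: complex_mat_mult_vec Re_exp Im_exp)
  also have "\<dots> = (?c t * ?c t + ?s t * ?s t) *\<^sub>R U t x"
    unfolding w_def scaleR_add_left
    by (simp add: matrix_vector_mult_diff_distrib matrix_vector_mult_scaleR A_mat_mult_A_mat_vec
        algebra_simps)
  also have "?c t * ?c t + ?s t * ?s t = 1"
    by (simp flip: power2_eq_square)
  finally show ?thesis using \<open>w t = Uin x\<close> by simp
qed

text \<open>The matrix averaged in the definition of the homogenized resolvent is the complex number
  \<open>1 / (p - i y)\<close>.\<close>

lemma resolvent_eq_complex_mat:
  assumes "0 < p"
  shows "(1 / (p\<^sup>2 + y\<^sup>2)) *\<^sub>R (vector [vector [p, y], vector [- y, p]] :: real ^ 2 ^ 2)
    = complex_mat (inverse (complex_of_real p - \<i> * complex_of_real y))"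
  by (simp add: complex_mat_vector vec_eq_iff forall_2 Re_inverse Im_inverse cmod_power2)

section \<open>The memory kernel of a compactly supported law\<close>

lemma iexp_mult_has_vector_derivative:
  "((\<lambda>t. iexp (t * y)) has_vector_derivative \<i> * complex_of_real y * iexp (t * y)) (at t)"
proof -
  have "((\<lambda>t. t * y) has_vector_derivative y) (at t)"
    by (auto intro!: derivative_eq_intros)
  from vector_diff_chain_at[OF this has_vector_derivative_iexp]
  show ?thesis by (simp add: o_def scaleR_conv_of_real ac_simps)
qed

text \<open>Comparison with the exponential series; it is applied to the Taylor coefficients of \<open>evol\<close>.\<close>

lemma power_series_exp_bound:
  fixes a :: "nat \<Rightarrow> complex"
  assumes "\<And>n. norm (a n) \<le> B * D ^ n / fact n"
  shows "summable (\<lambda>n. norm (a n * z ^ n))" and "norm (\<Sum>n. a n * z ^ n) \<le> B * exp (D * norm z)"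
proof -
  have s: "(\<lambda>n. B * ((D * norm z) ^ n /\<^sub>R fact n)) sums (B * exp (D * norm z))"
    by (intro sums_mult exp_converges)
  have le: "norm (a n * z ^ n) \<le> B * ((D * norm z) ^ n /\<^sub>R fact n)" for n
    using mult_right_mono[OF assms[of n], of "norm z ^ n"]
    by (simp add: norm_mult norm_power power_mult_distrib divide_simps)
  show 1: "summable (\<lambda>n. norm (a n * z ^ n))"
    by (rule summable_comparison_test'[OF sums_summable[OF s]]) (use le in simp)
  have "norm (\<Sum>n. a n * z ^ n) \<le> (\<Sum>n. norm (a n * z ^ n))"
    by (rule summable_norm[OF 1])
  also have "\<dots> \<le> B * exp (D * norm z)"
    by (subst sums_unique[OF s], rule suminf_le[OF le 1 sums_summable[OF s]])
  finally show "norm (\<Sum>n. a n * z ^ n) \<le> B * exp (D * norm z)" .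
qed

text \<open>The law \<open>\<mu>\<close> is to be thought of as the spectral measure of multiplication by \<open>y\<close>, with spectrum in
  \<open>[-R, R]\<close>. Since the integrands are polynomials or power series in \<open>y\<close>, bounds can only be expected
  for \<open>y\<close> in that interval, that is, almost everywhere.\<close>

locale compact_spectrum = prob_space \<mu> for \<mu> :: "real measure" +
  fixes R :: real
  assumes sets_eq [measurable_cong, simp]: "sets \<mu> = sets borel"
    and R_nonneg: "0 \<le> R"
    and AE_bounded: "AE y in \<mu>. \<bar>y\<bar> \<le> R"
begin

lemma integrable_bounded:
  fixes f :: "real \<Rightarrow> 'b::{banach, second_countable_topology}"
  assumes "f \<in> borel_measurable borel" and "\<And>y. \<bar>y\<bar> \<le> R \<Longrightarrow> norm (f y) \<le> C"
  shows "integrable \<mu> f"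
proof (rule integrable_const_bound)
  show "AE y in \<mu>. norm (f y) \<le> C"
    using AE_bounded by eventually_elim (rule assms(2))
qed (use assms(1) in measurable)

lemma norm_integral_bounded:
  fixes f :: "real \<Rightarrow> 'b::{banach, second_countable_topology}"
  assumes "\<And>y. \<bar>y\<bar> \<le> R \<Longrightarrow> norm (f y) \<le> C"
  shows "norm (\<integral>y. f y \<partial>\<mu>) \<le> C"
proof (cases "integrable \<mu> f")
  case True
  have "norm (\<integral>y. f y \<partial>\<mu>) \<le> (\<integral>y. norm (f y) \<partial>\<mu>)" by (rule integral_norm_bound)
  also have "\<dots> \<le> (\<integral>y. C \<partial>\<mu>)"
  proof (rule integral_mono_AE)
    show "AE y in \<mu>. norm (f y) \<le> C" using AE_bounded by eventually_elim (rule assms)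
  qed (use True in auto)
  finally show ?thesis by (simp add: prob_space)
next
  case False
  \<comment> \<open>The integral is 0 by convention here, so a sign condition on C is needed.\<close>
  have "0 \<le> C" using order.trans[OF norm_ge_zero assms[of 0]] R_nonneg by simp
  then show ?thesis using False by (simp add: not_integrable_integral_eq)
qed

text \<open>The iterates \<open>L\<^sup>n (y - m)\<close>, where \<open>m\<close> is the mean of \<open>\<mu>\<close> and \<open>L\<close> multiplies by \<open>y\<close> and then subtracts
  the mean. They are polynomials in \<open>y\<close>, so the exponential of \<open>i t L\<close> can be formed pointwise in \<open>y\<close>
  without reference to a space of square-integrable functions.\<close>

primrec orth_poly :: "nat \<Rightarrow> real \<Rightarrow> real" where
  "orth_poly 0 = (\<lambda>y. y - (\<integral>z. z \<partial>\<mu>))"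
| "orth_poly (Suc n) = (\<lambda>y. y * orth_poly n y - (\<integral>z. z * orth_poly n z \<partial>\<mu>))"

lemma orth_poly_measurable [measurable]: "orth_poly n \<in> borel_measurable borel"
  by (induction n) auto

lemma orth_poly_bound: "\<bar>y\<bar> \<le> R \<Longrightarrow> \<bar>orth_poly n y\<bar> \<le> 2 * R * (2 * R) ^ n"
proof (induction n arbitrary: y)
  case 0
  have "\<bar>\<integral>z. z \<partial>\<mu>\<bar> \<le> R"
    using norm_integral_bounded[of "\<lambda>z. z" R] by simp
  with 0 show ?case by simp
next
  case (Suc n)
  let ?B = "2 * R * (2 * R) ^ n"
  have step: "\<bar>z * orth_poly n z\<bar> \<le> R * ?B" if "\<bar>z\<bar> \<le> R" for z
    unfolding abs_mult by (intro mult_mono that Suc.IH R_nonneg) auto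
  have "\<bar>\<integral>z. z * orth_poly n z \<partial>\<mu>\<bar> \<le> R * ?B"
    using norm_integral_bounded[of "\<lambda>z. z * orth_poly n z" "R * ?B"] step by simp
  then show ?case using step[OF Suc.prems] by simp
qed

lemma mult_orth_poly_bound: "\<bar>y\<bar> \<le> R \<Longrightarrow> \<bar>y * orth_poly n y\<bar> \<le> 2 * R\<^sup>2 * (2 * R) ^ n"
  using mult_mono[OF _ orth_poly_bound R_nonneg, of "\<bar>y\<bar>" y n]
  by (simp add: abs_mult power2_eq_square ac_simps)

lemma integrable_mult_orth_poly: "integrable \<mu> (\<lambda>y. y * orth_poly n y)"
  by (rule integrable_bounded, simp, simp, erule mult_orth_poly_bound)

lemma integral_orth_poly: "(\<integral>y. orth_poly n y \<partial>\<mu>) = 0"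
proof (cases n)
  case 0
  have "integrable \<mu> (\<lambda>y. y)" by (rule integrable_bounded[where C = R]) auto
  then show ?thesis using 0 by (simp add: prob_space)
next
  case (Suc m)
  then show ?thesis using integrable_mult_orth_poly[of m] by (simp add: prob_space)
qed

definition evol_coeff :: "real \<Rightarrow> nat \<Rightarrow> complex" where
  "evol_coeff y n = complex_of_real (orth_poly n y) * \<i> ^ n / fact n"

text \<open>The orthogonal dynamics \<open>exp (i t L) (y - m)\<close>.\<close>

definition evol :: "real \<Rightarrow> real \<Rightarrow> complex" where
  "evol t y = (\<Sum>n. evol_coeff y n * complex_of_real t ^ n)"

definition memory :: "real \<Rightarrow> complex" where
  "memory t = - (\<integral>y. complex_of_real y * evol t y \<partial>\<mu>)"

lemma evol_coeff_bound: "\<bar>y\<bar> \<le> R \<Longrightarrow> norm (evol_coeff y n) \<le> 2 * R * (2 * R) ^ n / fact n"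
  using orth_poly_bound[of y n]
  by (simp add: evol_coeff_def norm_mult norm_divide norm_power divide_right_mono)

lemma evol_measurable [measurable]: "evol t \<in> borel_measurable borel"
  unfolding evol_def evol_coeff_def by measurable

lemma evol_bound: "\<bar>y\<bar> \<le> R \<Longrightarrow> norm (evol t y) \<le> 2 * R * exp (2 * R * \<bar>t\<bar>)"
  unfolding evol_def
  using power_series_exp_bound(2)[of "evol_coeff y" "2 * R" "2 * R" "complex_of_real t"] evol_coeff_bound
  by simp

lemma evol_0: "evol 0 y = complex_of_real (y - (\<integral>z. z \<partial>\<mu>))"
  using powser_zero[of "evol_coeff y"] by (simp add: evol_def evol_coeff_def)

text \<open>Sum and integral may be exchanged because the series is dominated by an exponential series,
  uniformly for \<open>y\<close> in the support.\<close>

lemma weighted_evol_sums: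
  fixes f :: "real \<Rightarrow> complex"
  assumes [measurable]: "f \<in> borel_measurable borel" and F: "\<And>y. \<bar>y\<bar> \<le> R \<Longrightarrow> norm (f y) \<le> F"
  shows "(\<lambda>n. \<integral>y. f y * (evol_coeff y n * complex_of_real t ^ n) \<partial>\<mu>) sums (\<integral>y. f y * evol t y \<partial>\<mu>)"
proof -
  let ?g = "\<lambda>n y. f y * (evol_coeff y n * complex_of_real t ^ n)"
  let ?B = "\<lambda>n. F * (2 * R) * ((2 * R * \<bar>t\<bar>) ^ n /\<^sub>R fact n)"
  have [measurable]: "(\<lambda>y. evol_coeff y n) \<in> borel_measurable borel" for n
    unfolding evol_coeff_def by measurable
  have F0: "0 \<le> F" using order.trans[OF norm_ge_zero F[of 0]] R_nonneg by simp
  have bd: "norm (?g n y) \<le> ?B n" if "\<bar>y\<bar> \<le> R" for n y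
  proof -
    have "norm (?g n y) = norm (f y) * (norm (evol_coeff y n) * \<bar>t\<bar> ^ n)"
      by (simp add: norm_mult norm_power)
    also have "\<dots> \<le> F * ((2 * R * (2 * R) ^ n / fact n) * \<bar>t\<bar> ^ n)"
      by (intro mult_mono F that evol_coeff_bound F0) (use R_nonneg in auto)
    also have "\<dots> = ?B n"
      by (simp add: power_mult_distrib divide_simps)
    finally show ?thesis .
  qed
  have sB: "summable ?B"
    by (intro summable_mult sums_summable[OF exp_converges])
  have "(\<lambda>n. \<integral>y. ?g n y \<partial>\<mu>) sums (\<integral>y. (\<Sum>n. ?g n y) \<partial>\<mu>)"
  proof (rule sums_integral)
    show "integrable \<mu> (?g n)" for n
      by (rule integrable_bounded[OF _ bd]) measurable
    show "AE y in \<mu>. summable (\<lambda>n. norm (?g n y))"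
      using AE_bounded by eventually_elim (rule summable_comparison_test'[OF sB, of 0], simp only: real_norm_def abs_norm_cancel bd)
    show "summable (\<lambda>n. \<integral>y. norm (?g n y) \<partial>\<mu>)"
      by (rule summable_comparison_test'[OF sB, of 0], rule norm_integral_bounded) (simp only: real_norm_def abs_norm_cancel bd)
  qed
  moreover have "(\<integral>y. (\<Sum>n. ?g n y) \<partial>\<mu>) = (\<integral>y. f y * evol t y \<partial>\<mu>)"
  proof (rule integral_cong_AE)
    show "AE y in \<mu>. (\<Sum>n. ?g n y) = f y * evol t y"
      using AE_bounded
    proof eventually_elim
      case (elim y)
      show ?case unfolding evol_def
        by (rule suminf_mult[symmetric, symmetric])
          (rule summable_norm_cancel[OF power_series_exp_bound(1)[OF evol_coeff_bound[OF elim]]])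
    qed
  qed measurable
  ultimately show ?thesis by simp
qed

lemma integral_evol: "(\<integral>y. evol t y \<partial>\<mu>) = 0"
proof -
  have 0: "(\<integral>y. evol_coeff y n \<partial>\<mu>) = 0" for n
    using integral_orth_poly[of n] by (simp add: evol_coeff_def)
  then have "(\<lambda>n. 0) sums (\<integral>y. 1 * evol t y \<partial>\<mu>)"
    using weighted_evol_sums[of "\<lambda>_. 1" 1 t] by (simp add: 0)
  then show ?thesis using sums_unique2[OF sums_zero] by fastforce
qed

text \<open>The series is differentiated termwise. The recursion for \<open>orth_poly\<close> splits the differentiated series
  into \<open>i y\<close> times the series itself and the power series of \<open>memory\<close>.\<close>

lemma evol_has_vector_derivative:
  assumes y: "\<bar>y\<bar> \<le> R"
  shows "((\<lambda>t. evol t y) has_vector_derivative \<i> * (complex_of_real y * evol t y + memory t)) (at t)"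
proof -
  define m where "m n = complex_of_real (\<integral>z. z * orth_poly n z \<partial>\<mu>) * \<i> ^ n / fact n" for n
  have sm: "(\<lambda>n. m n * complex_of_real t ^ n) sums (- memory t)"
  proof -
    have "(\<integral>z. complex_of_real z * (evol_coeff z n * complex_of_real t ^ n) \<partial>\<mu>)
        = (\<integral>z. complex_of_real (z * orth_poly n z) * (\<i> ^ n / fact n * complex_of_real t ^ n) \<partial>\<mu>)" for n
      by (rule Bochner_Integration.integral_cong) (auto simp: evol_coeff_def)
    then have "(\<integral>z. complex_of_real z * (evol_coeff z n * complex_of_real t ^ n) \<partial>\<mu>) = m n * complex_of_real t ^ n" for n
      by (simp add: m_def del: of_real_mult)
    then show ?thesis
      using weighted_evol_sums[of complex_of_real R t] by (simp add: memory_def)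
  qed
  have su: "summable (\<lambda>n. evol_coeff y n * z ^ n)" for z
    by (rule summable_norm_cancel[OF power_series_exp_bound(1)[OF evol_coeff_bound[OF y]]])
  have d: "diffs (evol_coeff y) n = \<i> * (complex_of_real y * evol_coeff y n - m n)" for n
    by (simp add: diffs_def evol_coeff_def m_def field_simps del: of_nat_Suc)
  have "(\<Sum>n. diffs (evol_coeff y) n * complex_of_real t ^ n)
      = (\<Sum>n. \<i> * (complex_of_real y * (evol_coeff y n * complex_of_real t ^ n) - m n * complex_of_real t ^ n))"
    by (rule suminf_cong) (simp only: d, simp add: algebra_simps)
  also have "\<dots> = \<i> * (complex_of_real y * evol t y - (- memory t))"
    unfolding evol_def
    by (intro sums_unique[symmetric] sums_mult sums_diff sm summable_sums su)
  finally show ?thesis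
    using has_vector_derivative_real_field[OF termdiffs_strong_converges_everywhere[OF su, of "complex_of_real t"]]
    by (simp add: evol_def)
qed

lemma has_vector_derivative_integral_bounded:
  fixes f f' :: "real \<Rightarrow> real \<Rightarrow> 'b::{banach, second_countable_topology}"
  assumes f_meas: "\<And>t. f t \<in> borel_measurable borel"
    and f'_meas: "\<And>t. f' t \<in> borel_measurable borel"
    and f_bound: "\<And>t y. \<bar>y\<bar> \<le> R \<Longrightarrow> norm (f t y) \<le> C t"
    and f'_bound: "\<And>t y T. \<bar>y\<bar> \<le> R \<Longrightarrow> \<bar>t\<bar> \<le> T \<Longrightarrow> norm (f' t y) \<le> D T"
    and deriv: "\<And>t y. \<bar>y\<bar> \<le> R \<Longrightarrow> ((\<lambda>s. f s y) has_vector_derivative f' t y) (at t)"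
  shows "((\<lambda>t. \<integral>y. f t y \<partial>\<mu>) has_vector_derivative (\<integral>y. f' t y \<partial>\<mu>)) (at t)"
proof (rule has_vector_derivative_integral)
  show "integrable \<mu> (f t)" for t by (rule integrable_bounded[OF f_meas f_bound])
  show "f' t \<in> borel_measurable \<mu>" for t using f'_meas by measurable
  show "AE y in \<mu>. \<forall>t. ((\<lambda>s. f s y) has_vector_derivative f' t y) (at t)"
    using AE_bounded by eventually_elim (use deriv in blast)
  show "\<exists>C. AE y in \<mu>. \<forall>t. \<bar>t\<bar> \<le> T \<longrightarrow> norm (f' t y) \<le> C" for T
    using AE_bounded by (intro exI[of _ "D T"], eventually_elim) (use f'_bound in blast)
qed

lemma norm_memory_le: "\<bar>t\<bar> \<le> T \<Longrightarrow> norm (memory t) \<le> R * (2 * R * exp (2 * R * T))"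
proof -
  assume "\<bar>t\<bar> \<le> T"
  then have "exp (2 * R * \<bar>t\<bar>) \<le> exp (2 * R * T)" using R_nonneg by (simp add: mult_left_mono)
  then have "norm (complex_of_real y * evol t y) \<le> R * (2 * R * exp (2 * R * T))" if "\<bar>y\<bar> \<le> R" for y
    unfolding norm_mult norm_of_real
    by (intro mult_mono that order.trans[OF evol_bound[OF that]]) (use R_nonneg in auto)
  then show ?thesis unfolding memory_def by (simp add: norm_integral_bounded)
qed

lemma norm_evol_deriv_le:
  assumes "\<bar>y\<bar> \<le> R" "\<bar>t\<bar> \<le> T"
  shows "norm (\<i> * (complex_of_real y * evol t y + memory t)) \<le> 2 * (R * (2 * R * exp (2 * R * T)))"
proof -
  have "exp (2 * R * \<bar>t\<bar>) \<le> exp (2 * R * T)" using R_nonneg assms by (simp add: mult_left_mono)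
  then have "norm (complex_of_real y * evol t y) \<le> R * (2 * R * exp (2 * R * T))"
    unfolding norm_mult norm_of_real
    by (intro mult_mono assms order.trans[OF evol_bound[OF assms(1)]]) (use R_nonneg in auto)
  then show ?thesis
    using norm_triangle_ineq[of "complex_of_real y * evol t y" "memory t"] norm_memory_le[OF assms(2)]
    by (simp add: norm_mult)
qed

text \<open>The kernel is differentiable, as the mean of \<open>y\<close> times the differentiable function \<open>evol\<close>.\<close>

lemma continuous_on_memory: "continuous_on S memory"
proof -
  have "((\<lambda>t. \<integral>y. complex_of_real y * evol t y \<partial>\<mu>) has_vector_derivative
      (\<integral>y. complex_of_real y * (\<i> * (complex_of_real y * evol t y + memory t)) \<partial>\<mu>)) (at t)" for t
  proof (rule has_vector_derivative_integral_bounded)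
    show "norm (complex_of_real y * evol s y) \<le> R * (2 * R * exp (2 * R * \<bar>s\<bar>))" if "\<bar>y\<bar> \<le> R" for s y
      unfolding norm_mult norm_of_real
      by (intro mult_mono that evol_bound[OF that]) (use R_nonneg in auto)
    show "norm (complex_of_real y * (\<i> * (complex_of_real y * evol s y + memory s)))
        \<le> R * (2 * (R * (2 * R * exp (2 * R * T))))" if "\<bar>y\<bar> \<le> R" "\<bar>s\<bar> \<le> T" for s y T
      unfolding norm_mult[of "complex_of_real y"] norm_of_real
      by (intro mult_mono that norm_evol_deriv_le[OF that]) (use R_nonneg in auto)
    show "((\<lambda>t. complex_of_real y * evol t y) has_vector_derivative
        complex_of_real y * (\<i> * (complex_of_real y * evol s y + memory s))) (at s)"
      if "\<bar>y\<bar> \<le> R" for s y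
      by (intro has_vector_derivative_mult_right evol_has_vector_derivative that)
  qed measurable
  then show ?thesis unfolding memory_def
    by (intro continuous_on_minus continuous_at_imp_continuous_on ballI has_vector_derivative_continuous)
qed

text \<open>Conservation of energy: this is the unitarity of \<open>exp (i t L)\<close>, and it is what keeps the kernel
  bounded for all times.\<close>

lemma integral_norm_evol_sq:
  "(\<integral>y. (norm (evol t y))\<^sup>2 \<partial>\<mu>) = (\<integral>y. (norm (evol 0 y))\<^sup>2 \<partial>\<mu>)"
proof -
  let ?u' = "\<lambda>t y. \<i> * (complex_of_real y * evol t y + memory t)"
  let ?e = "\<lambda>t. \<integral>y. evol t y \<bullet> evol t y \<partial>\<mu>"
  have "(?e has_vector_derivative 0) (at t)" for t
  proof -
    have "(?e has_vector_derivative (\<integral>y. evol t y \<bullet> ?u' t y + ?u' t y \<bullet> evol t y \<partial>\<mu>)) (at t)"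
    proof (rule has_vector_derivative_integral_bounded)
      show "norm (evol t y \<bullet> evol t y) \<le> (2 * R * exp (2 * R * \<bar>t\<bar>))\<^sup>2" if "\<bar>y\<bar> \<le> R" for t y
        using evol_bound[OF that, of t] by (simp add: dot_square_norm power_mono)
      show "norm (evol t y \<bullet> ?u' t y + ?u' t y \<bullet> evol t y)
          \<le> 2 * ((2 * R * exp (2 * R * T)) * (2 * (R * (2 * R * exp (2 * R * T)))))"
        if y: "\<bar>y\<bar> \<le> R" and t: "\<bar>t\<bar> \<le> T" for t y T
      proof -
        have "exp (2 * R * \<bar>t\<bar>) \<le> exp (2 * R * T)" using R_nonneg t by (simp add: mult_left_mono)
        then have u: "norm (evol t y) \<le> 2 * R * exp (2 * R * T)"
          using order.trans[OF evol_bound[OF y, of t]] R_nonneg by (simp add: mult_left_mono)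
        have "norm (evol t y \<bullet> ?u' t y) \<le> norm (evol t y) * norm (?u' t y)"
          by (simp only: real_norm_def Cauchy_Schwarz_ineq2)
        also have "\<dots> \<le> (2 * R * exp (2 * R * T)) * (2 * (R * (2 * R * exp (2 * R * T))))"
          by (intro mult_mono u norm_evol_deriv_le[OF y t]) (use R_nonneg in auto)
        finally show ?thesis by (simp add: inner_commute)
      qed
      show "((\<lambda>t. evol t y \<bullet> evol t y) has_vector_derivative evol t y \<bullet> ?u' t y + ?u' t y \<bullet> evol t y) (at t)"
        if "\<bar>y\<bar> \<le> R" for t y
        using bounded_bilinear.has_vector_derivative[OF bounded_bilinear_inner
            evol_has_vector_derivative[OF that] evol_has_vector_derivative[OF that]] .
    qed measurable
    \<comment> \<open>Multiplication by i y rotates evol t y by a right angle, so that part of the derivative is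
      orthogonal to evol t y; the other part does not depend on y.\<close>
    also have "(\<integral>y. evol t y \<bullet> ?u' t y + ?u' t y \<bullet> evol t y \<partial>\<mu>) = (\<integral>y. evol t y \<bullet> (2 * \<i> * memory t) \<partial>\<mu>)"
      by (rule Bochner_Integration.integral_cong) (auto simp: inner_complex_def algebra_simps)
    also have "\<dots> = (\<integral>y. evol t y \<partial>\<mu>) \<bullet> (2 * \<i> * memory t)"
      by (rule integral_inner_left, rule integrable_bounded[OF _ evol_bound]) auto
    also have "\<dots> = 0" by (simp add: integral_evol)
    finally show ?thesis .
  qed
  then obtain c where "\<And>t. ?e t = c"
    using has_vector_derivative_zero_constant[of UNIV ?e] by auto
  then have "?e t = ?e 0" by simp
  then show ?thesis by (simp add: dot_square_norm)
qed

text \<open>Any bound of the mean of \<open>|evol t|\<close> that does not depend on \<open>t\<close> would do; this one comes from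
  \<open>|u| \<le> (1 + |u|\<^sup>2) / 2\<close>.\<close>

definition evol_L1_bound :: real where
  "evol_L1_bound = (1 + (\<integral>y. (norm (evol 0 y))\<^sup>2 \<partial>\<mu>)) / 2"

lemma integral_norm_evol_le: "(\<integral>y. norm (evol t y) \<partial>\<mu>) \<le> evol_L1_bound"
proof -
  have int: "integrable \<mu> (\<lambda>y. (norm (evol t y))\<^sup>2)"
    using power_mono[OF evol_bound, where n = 2]
    by (intro integrable_bounded[where C = "(2 * R * exp (2 * R * \<bar>t\<bar>))\<^sup>2"]) auto
  have "(\<integral>y. norm (evol t y) \<partial>\<mu>) \<le> (\<integral>y. (1 + (norm (evol t y))\<^sup>2) / 2 \<partial>\<mu>)"
  proof (rule integral_mono)
    show "integrable \<mu> (\<lambda>y. norm (evol t y))"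
      by (rule integrable_norm, rule integrable_bounded[OF _ evol_bound]) auto
    show "norm (evol t y) \<le> (1 + (norm (evol t y))\<^sup>2) / 2" for y
      using zero_le_power2[of "norm (evol t y) - 1"] by (simp add: power2_diff)
  qed (use int in auto)
  also have "\<dots> = evol_L1_bound"
    using int by (simp add: evol_L1_bound_def prob_space integral_norm_evol_sq[of t])
  finally show ?thesis .
qed

lemma norm_integral_evol_le:
  assumes [measurable]: "f \<in> borel_measurable borel" and F: "\<And>y. \<bar>y\<bar> \<le> R \<Longrightarrow> norm (f y) \<le> F"
  shows "norm (\<integral>y. f y * evol t y \<partial>\<mu>) \<le> F * evol_L1_bound"
proof -
  have F0: "0 \<le> F" using order.trans[OF norm_ge_zero F[of 0]] R_nonneg by simp
  have le: "norm (f y * evol t y) \<le> F * norm (evol t y)" if "\<bar>y\<bar> \<le> R" for y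
    using F[OF that] by (simp add: norm_mult mult_right_mono)
  have int: "integrable \<mu> (\<lambda>y. norm (evol t y))"
    by (rule integrable_norm, rule integrable_bounded[OF _ evol_bound]) auto
  have "norm (\<integral>y. f y * evol t y \<partial>\<mu>) \<le> (\<integral>y. norm (f y * evol t y) \<partial>\<mu>)"
    by (rule integral_norm_bound)
  also have "\<dots> \<le> (\<integral>y. F * norm (evol t y) \<partial>\<mu>)"
  proof (rule integral_mono_AE')
    show "AE y in \<mu>. norm (f y * evol t y) \<le> F * norm (evol t y)"
      using AE_bounded by eventually_elim (rule le)
  qed (use int F0 in auto)
  also have "\<dots> \<le> F * evol_L1_bound"
    using integral_norm_evol_le F0 by (simp add: mult_left_mono)
  finally show ?thesis .
qed

lemma norm_memory_le_const: "norm (memory t) \<le> R * evol_L1_bound"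
  using norm_integral_evol_le[of complex_of_real R t] by (simp add: memory_def)

lemma integrable_iexp:
  "integrable \<mu> (\<lambda>y. iexp (t * y))" "integrable \<mu> (\<lambda>y. complex_of_real y * iexp (t * y))"
  by (rule integrable_bounded[where C = 1], simp, simp)
    (rule integrable_bounded[where C = R], auto simp: norm_mult)

lemma char_has_vector_derivative:
  "(char \<mu> has_vector_derivative (\<integral>y. \<i> * complex_of_real y * iexp (t * y) \<partial>\<mu>)) (at t)"
proof -
  have "((\<lambda>t. \<integral>y. iexp (t * y) \<partial>\<mu>) has_vector_derivative (\<integral>y. \<i> * complex_of_real y * iexp (t * y) \<partial>\<mu>)) (at t)"
  proof (rule has_vector_derivative_integral_bounded)
    show "((\<lambda>t. iexp (t * y)) has_vector_derivative \<i> * complex_of_real y * iexp (t * y)) (at t)" for t y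
      by (rule iexp_mult_has_vector_derivative)
    show "norm (iexp (t * y)) \<le> 1" for t y by simp
    show "norm (\<i> * complex_of_real y * iexp (t * y)) \<le> R" if "\<bar>y\<bar> \<le> R" for t y
      using that by (simp add: norm_mult)
  qed measurable
  then show ?thesis unfolding char_def .
qed

lemma continuous_on_char: "continuous_on S (char \<mu>)"
  by (rule continuous_at_imp_continuous_on, rule ballI)
    (rule has_vector_derivative_continuous[OF char_has_vector_derivative])

lemma char_at_zero: "char \<mu> 0 = 1"
  by (simp add: char_def prob_space)

lemma norm_char_le_1: "norm (char \<mu> t) \<le> 1"
  unfolding char_def by (rule norm_integral_bounded) simp

text \<open>The mean of \<open>exp (i s y) evol (t - s) y\<close> is followed from \<open>s = 0\<close>, where it vanishes, to \<open>s = t\<close>, where it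
  is the right-hand side up to a factor \<open>- i\<close>. Its derivative is a product of \<open>memory\<close> and \<open>char\<close>, because
  the two terms with the factor \<open>i y\<close> cancel.\<close>

lemma memory_equation:
  assumes t: "0 \<le> t"
  shows "(LINT s:{0..t}|lborel. memory (t - s) * char \<mu> s)
    = (\<integral>y. \<i> * complex_of_real y * iexp (t * y) \<partial>\<mu>) - \<i> * complex_of_real (\<integral>y. y \<partial>\<mu>) * char \<mu> t"
proof -
  define g where "g s = (\<integral>y. iexp (s * y) * evol (t - s) y \<partial>\<mu>)" for s
  define g' where "g' s y = iexp (s * y) * (- \<i> * memory (t - s))" for s y
  have g: "(g has_vector_derivative - \<i> * (memory (t - s) * char \<mu> s)) (at s)" for s
  proof -
    have "(g has_vector_derivative (\<integral>y. g' s y \<partial>\<mu>)) (at s)"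
      unfolding g_def
    proof (rule has_vector_derivative_integral_bounded)
      show "norm (iexp (s * y) * evol (t - s) y) \<le> 2 * R * exp (2 * R * \<bar>t - s\<bar>)" if "\<bar>y\<bar> \<le> R" for s y
        using evol_bound[OF that] by (simp add: norm_mult)
      show "norm (g' s y) \<le> R * evol_L1_bound" for s y
        using norm_memory_le_const by (simp add: norm_mult g'_def)
      show "((\<lambda>s. iexp (s * y) * evol (t - s) y) has_vector_derivative g' s y) (at s)" if "\<bar>y\<bar> \<le> R" for s y
      proof -
        have "((\<lambda>s. t - s) has_vector_derivative - 1) (at s)"
          by (auto intro!: derivative_eq_intros)
        from vector_diff_chain_at[OF this evol_has_vector_derivative[OF that]]
        have 2: "((\<lambda>s. evol (t - s) y) has_vector_derivative
            - (\<i> * (complex_of_real y * evol (t - s) y + memory (t - s)))) (at s)"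
          by (simp add: o_def)
        show ?thesis
          using has_vector_derivative_mult[OF iexp_mult_has_vector_derivative[of y s] 2] by (simp add: g'_def algebra_simps)
      qed
    qed (unfold g'_def, measurable)
    also have "(\<integral>y. g' s y \<partial>\<mu>) = - \<i> * (memory (t - s) * char \<mu> s)"
      unfolding g'_def using integrable_iexp(1)[of s]
      by (simp add: char_def)
    finally show ?thesis .
  qed
  have "(LINT s:{0..t}|lborel. - \<i> * (memory (t - s) * char \<mu> s)) = g t - g 0"
    unfolding set_lebesgue_integral_def
  proof (rule integral_FTC_atLeastAtMost[OF t])
    show "(g has_vector_derivative - \<i> * (memory (t - s) * char \<mu> s)) (at s within {0..t})" for s
      by (rule has_vector_derivative_at_within[OF g])
    show "continuous_on {0..t} (\<lambda>s. - \<i> * (memory (t - s) * char \<mu> s))"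
      by (intro continuous_intros continuous_on_char continuous_on_compose2[OF continuous_on_memory[of UNIV]]) auto
  qed
  moreover have "g 0 = 0" by (simp add: g_def integral_evol)
  moreover have "g t = (\<integral>y. complex_of_real y * iexp (t * y) \<partial>\<mu>) - complex_of_real (\<integral>y. y \<partial>\<mu>) * char \<mu> t"
    using integrable_iexp[of t]
    by (simp add: g_def evol_0 char_def algebra_simps)
  ultimately have "- \<i> * (LINT s:{0..t}|lborel. memory (t - s) * char \<mu> s)
      = (\<integral>y. complex_of_real y * iexp (t * y) \<partial>\<mu>) - complex_of_real (\<integral>y. y \<partial>\<mu>) * char \<mu> t"
    by (simp only: set_integral_mult_right diff_zero)
  then have "\<i> * (- \<i> * (LINT s:{0..t}|lborel. memory (t - s) * char \<mu> s))
      = \<i> * ((\<integral>y. complex_of_real y * iexp (t * y) \<partial>\<mu>) - complex_of_real (\<integral>y. y \<partial>\<mu>) * char \<mu> t)"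
    by (rule arg_cong)
  then show ?thesis by (simp add: algebra_simps)
qed

text \<open>The Laplace transform of the characteristic function: \<open>1 / (p - i y)\<close> is the transform of
  \<open>exp (i t y)\<close>.\<close>

definition char_laplace :: "real \<Rightarrow> complex" where
  "char_laplace p = (\<integral>y. inverse (complex_of_real p - \<i> * complex_of_real y) \<partial>\<mu>)"

lemma norm_resolvent_le:
  assumes "0 < p"
  shows "norm (inverse (complex_of_real p - \<i> * complex_of_real y)) \<le> inverse p"
proof -
  have "p \<le> norm (complex_of_real p - \<i> * complex_of_real y)"
    using complex_Re_le_cmod[of "complex_of_real p - \<i> * complex_of_real y"] by simp
  then show ?thesis using assms by (simp add: norm_inverse le_imp_inverse_le)
qed

lemma integrable_resolvent: "0 < p \<Longrightarrow> integrable \<mu> (\<lambda>y. inverse (complex_of_real p - \<i> * complex_of_real y))"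
  by (rule integrable_bounded[OF _ norm_resolvent_le]) auto

text \<open>The real part of \<open>1 / (p - i y)\<close> is at least \<open>p / (p\<^sup>2 + R\<^sup>2)\<close> on the support.\<close>

lemma char_laplace_nonzero:
  assumes p: "0 < p"
  shows "char_laplace p \<noteq> 0"
proof -
  have Re: "Re (inverse (complex_of_real p - \<i> * complex_of_real y)) = p / (p\<^sup>2 + y\<^sup>2)" for y
    by (simp add: Re_inverse cmod_power2)
  have "p / (p\<^sup>2 + R\<^sup>2) = (\<integral>y. p / (p\<^sup>2 + R\<^sup>2) \<partial>\<mu>)"
    by (simp add: prob_space)
  also have "\<dots> \<le> (\<integral>y. Re (inverse (complex_of_real p - \<i> * complex_of_real y)) \<partial>\<mu>)"
  proof (rule integral_mono_AE)
    show "AE y in \<mu>. p / (p\<^sup>2 + R\<^sup>2) \<le> Re (inverse (complex_of_real p - \<i> * complex_of_real y))"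
      using AE_bounded
    proof eventually_elim
      case (elim y)
      have "y\<^sup>2 \<le> R\<^sup>2" using elim by (metis abs_ge_zero power2_abs power_mono)
      then show ?case unfolding Re using p by (intro divide_left_mono) (auto simp: add_pos_nonneg)
    qed
    show "integrable \<mu> (\<lambda>y. Re (inverse (complex_of_real p - \<i> * complex_of_real y)))"
      by (rule integrable_Re[OF integrable_resolvent[OF p]])
  qed auto
  also have "\<dots> = Re (char_laplace p)"
    unfolding char_laplace_def by (rule integral_Re[OF integrable_resolvent[OF p]])
  finally have "0 < Re (char_laplace p)"
    using p by (smt (verit) add_pos_nonneg divide_pos_pos zero_le_power2 zero_less_power)
  then show ?thesis by auto
qed

text \<open>The function \<open>G s\<close>, the mean of \<open>exp (- p s) evol s y / (p - i y)\<close>, tends to zero at infinity because the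
  mean of \<open>|evol s|\<close> is bounded. Its derivative is a constant times the Laplace integrand of the kernel, since multiplying
  \<open>i y\<close> by the resolvent gives \<open>p / (p - i y) - 1\<close> and \<open>evol\<close> has mean zero. So the Laplace integral can be
  read off from \<open>G 0\<close>.\<close>

lemma laplace_memory:
  assumes p: "0 < p"
  shows "set_integrable lebesgue {0..} (\<lambda>s. exp (- p * s) *\<^sub>R memory s)"
    and "(LINT s:{0..}|lebesgue. exp (- p * s) *\<^sub>R memory s)
      = p - \<i> * complex_of_real (\<integral>y. y \<partial>\<mu>) - inverse (char_laplace p)"
proof -
  let ?r = "\<lambda>y. inverse (complex_of_real p - \<i> * complex_of_real y)"
  let ?u' = "\<lambda>t y. \<i> * (complex_of_real y * evol t y + memory t)"
  have r_nz: "complex_of_real p - \<i> * complex_of_real y \<noteq> 0" for y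
    using p by (auto simp: complex_eq_iff)
  have [measurable]: "memory \<in> borel_measurable borel"
    by (rule borel_measurable_continuous_onI[OF continuous_on_memory])
  show int: "set_integrable lebesgue {0..} (\<lambda>s. exp (- p * s) *\<^sub>R memory s)"
  proof (rule set_integrable_bound)
    show "set_integrable lebesgue {0..} (\<lambda>s. exp (- p * s) * (R * evol_L1_bound))"
      by (intro set_integrable_mult_left nonnegative_absolutely_integrable_1 integrable_on_exp_minus_to_infinity p) auto
    show "set_borel_measurable lebesgue {0..} (\<lambda>s. exp (- p * s) *\<^sub>R memory s)"
      unfolding set_borel_measurable_def
      by (rule measurable_completion) measurable
    show "AE s in lebesgue. s \<in> {0..} \<longrightarrow> norm (exp (- p * s) *\<^sub>R memory s) \<le> norm (exp (- p * s) * (R * evol_L1_bound))"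
      using norm_memory_le_const abs_ge_self order_trans
      by (intro AE_I2) (fastforce simp: abs_mult intro!: mult_left_mono)
  qed
  define G where "G s = exp (- p * s) *\<^sub>R (\<integral>y. ?r y * evol s y \<partial>\<mu>)" for s
  have G: "(G has_vector_derivative (\<i> * char_laplace p) * (exp (- p * s) *\<^sub>R memory s)) (at s)" for s
  proof -
    have "((\<lambda>s. \<integral>y. ?r y * evol s y \<partial>\<mu>) has_vector_derivative (\<integral>y. ?r y * ?u' s y \<partial>\<mu>)) (at s)"
    proof (rule has_vector_derivative_integral_bounded)
      show "norm (?r y * evol s y) \<le> inverse p * (2 * R * exp (2 * R * \<bar>s\<bar>))" if "\<bar>y\<bar> \<le> R" for s y
        unfolding norm_mult by (intro mult_mono norm_resolvent_le p evol_bound that) (use p in auto)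
      show "norm (?r y * ?u' s y) \<le> inverse p * (2 * (R * (2 * R * exp (2 * R * T))))"
        if "\<bar>y\<bar> \<le> R" "\<bar>s\<bar> \<le> T" for s y T
        unfolding norm_mult[of "?r y"]
        by (intro mult_mono norm_resolvent_le p norm_evol_deriv_le that) (use p in auto)
      show "((\<lambda>s. ?r y * evol s y) has_vector_derivative ?r y * ?u' s y) (at s)" if "\<bar>y\<bar> \<le> R" for s y
        by (intro has_vector_derivative_mult_right evol_has_vector_derivative that)
    qed measurable
    also have "(\<integral>y. ?r y * ?u' s y \<partial>\<mu>) = (\<integral>y. p * (?r y * evol s y) + (?r y * (\<i> * memory s) - evol s y) \<partial>\<mu>)"
    proof (rule Bochner_Integration.integral_cong[OF refl])
      fix y
      \<comment> \<open>Write i y as p minus (p - i y); the resolvent then cancels p - i y.\<close>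
      have "?r y * ?u' s y = p * (?r y * evol s y) + ?r y * (\<i> * memory s)
          - ?r y * (complex_of_real p - \<i> * complex_of_real y) * evol s y"
        by (simp add: algebra_simps)
      then show "?r y * ?u' s y = p * (?r y * evol s y) + (?r y * (\<i> * memory s) - evol s y)"
        using r_nz[of y] by simp
    qed
    also have "\<dots> = p * (\<integral>y. ?r y * evol s y \<partial>\<mu>) + char_laplace p * (\<i> * memory s)"
    proof -
      have 1: "integrable \<mu> (\<lambda>y. ?r y * evol s y)"
      proof (rule integrable_bounded)
        show "norm (?r y * evol s y) \<le> inverse p * (2 * R * exp (2 * R * \<bar>s\<bar>))" if "\<bar>y\<bar> \<le> R" for y
          unfolding norm_mult by (intro mult_mono norm_resolvent_le p evol_bound that) (use p in auto)
      qed measurable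
      have 2: "integrable \<mu> (\<lambda>y. evol s y)" by (rule integrable_bounded[OF _ evol_bound]) auto
      show ?thesis
        using 1 2 integrable_resolvent[OF p] by (simp add: integral_evol char_laplace_def)
    qed
    finally have D: "((\<lambda>s. \<integral>y. ?r y * evol s y \<partial>\<mu>) has_vector_derivative
        (p * (\<integral>y. ?r y * evol s y \<partial>\<mu>) + char_laplace p * (\<i> * memory s))) (at s)" .
    have E: "((\<lambda>s. exp (- p * s)) has_field_derivative - p * exp (- p * s)) (at s)"
      by (auto intro!: derivative_eq_intros)
    show ?thesis
      using has_vector_derivative_scaleR[OF E D]
      by (simp add: G_def[abs_def] scaleR_conv_of_real algebra_simps)
  qed
  have L1: "((\<lambda>T. LINT s:{0..T}|lebesgue. (\<i> * char_laplace p) * (exp (- p * s) *\<^sub>R memory s)) \<longlongrightarrow> - G 0) at_top"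
  proof (rule Lim_transform_eventually)
    show "((\<lambda>T. G T - G 0) \<longlongrightarrow> - G 0) at_top"
    proof -
      have "(G \<longlongrightarrow> 0) at_top"
      proof (rule Lim_null_comparison)
        show "\<forall>\<^sub>F T in at_top. norm (G T) \<le> exp (- p * T) * (inverse p * evol_L1_bound)"
          unfolding G_def norm_scaleR
          by (intro always_eventually allI mult_mono norm_integral_evol_le norm_resolvent_le p) auto
        show "((\<lambda>T. exp (- p * T) * (inverse p * evol_L1_bound)) \<longlongrightarrow> 0) at_top"
          using p by real_asymp
      qed
      then show ?thesis using tendsto_diff[OF _ tendsto_const, of G 0 at_top "G 0"] by simp
    qed
    show "\<forall>\<^sub>F T in at_top. G T - G 0 = (LINT s:{0..T}|lebesgue. (\<i> * char_laplace p) * (exp (- p * s) *\<^sub>R memory s))"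
      using eventually_ge_at_top[of 0]
    proof eventually_elim
      case (elim T)
      have c: "continuous_on {0..T} (\<lambda>s. (\<i> * char_laplace p) * (exp (- p * s) *\<^sub>R memory s))"
        by (intro continuous_intros continuous_on_memory)
      have "(LINT s:{0..T}|lborel. (\<i> * char_laplace p) * (exp (- p * s) *\<^sub>R memory s)) = G T - G 0"
        unfolding set_lebesgue_integral_def
        by (rule integral_FTC_atLeastAtMost[OF elim has_vector_derivative_at_within[OF G] c])
      then show ?case unfolding set_lebesgue_integral_def
        by (subst integral_completion) auto
    qed
  qed
  have int': "set_integrable lebesgue {0..} (\<lambda>s. (\<i> * char_laplace p) * (exp (- p * s) *\<^sub>R memory s))"
    by (rule set_integrable_mult_right) (rule int)
  have L2: "((\<lambda>T. LINT s:{0..T}|lebesgue. (\<i> * char_laplace p) * (exp (- p * s) *\<^sub>R memory s)) \<longlongrightarrow>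
      (LINT s:{0..}|lebesgue. (\<i> * char_laplace p) * (exp (- p * s) *\<^sub>R memory s))) at_top"
    by (rule tendsto_set_lebesgue_integral_at_top[OF _ int']) auto
  have eq: "(\<i> * char_laplace p) * (LINT s:{0..}|lebesgue. exp (- p * s) *\<^sub>R memory s) = - G 0"
    using tendsto_unique[OF trivial_limit_at_top_linorder L2 L1]
    by (simp only: set_integral_mult_right)
  \<comment> \<open>evol 0 y is y minus the mean, and y = i (p - i y) - i p.\<close>
  have "?r y * evol 0 y = \<i> + (- \<i> * p - complex_of_real (\<integral>y. y \<partial>\<mu>)) * ?r y" for y
  proof -
    have "?r y * evol 0 y = \<i> * (?r y * (complex_of_real p - \<i> * complex_of_real y))
        + (- \<i> * p - complex_of_real (\<integral>y. y \<partial>\<mu>)) * ?r y"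
      by (simp add: evol_0 algebra_simps)
    then show ?thesis using r_nz[of y] by simp
  qed
  then have "G 0 = \<i> + (- \<i> * p - complex_of_real (\<integral>y. y \<partial>\<mu>)) * char_laplace p"
    using integrable_resolvent[OF p] by (simp add: G_def char_laplace_def prob_space)
  then have "- \<i> * ((\<i> * char_laplace p) * (LINT s:{0..}|lebesgue. exp (- p * s) *\<^sub>R memory s))
      = - \<i> * (- (\<i> + (- \<i> * p - complex_of_real (\<integral>y. y \<partial>\<mu>)) * char_laplace p))"
    by (simp only: eq)
  then have "char_laplace p * (LINT s:{0..}|lebesgue. exp (- p * s) *\<^sub>R memory s)
      = char_laplace p * (p - \<i> * complex_of_real (\<integral>y. y \<partial>\<mu>)) - 1"
    by (simp add: algebra_simps)
  then have "char_laplace p * (LINT s:{0..}|lebesgue. exp (- p * s) *\<^sub>R memory s)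
      = char_laplace p * (p - \<i> * complex_of_real (\<integral>y. y \<partial>\<mu>) - inverse (char_laplace p))"
    using char_laplace_nonzero[OF p] by (simp add: right_diff_distrib)
  then show "(LINT s:{0..}|lebesgue. exp (- p * s) *\<^sub>R memory s)
      = p - \<i> * complex_of_real (\<integral>y. y \<partial>\<mu>) - inverse (char_laplace p)"
    using char_laplace_nonzero[OF p] by simp
qed

text \<open>The matrix form of \<open>memory_equation\<close>, applied to a vector.\<close>

lemma char_solves_memory:
  fixes v :: "real ^ 2"
  defines "u \<equiv> \<lambda>t. complex_mat (char \<mu> t) *v v"
  shows "u 0 = v" and "continuous_on S u" and "u differentiable (at t)"
    and "0 < t \<Longrightarrow> set_integrable lebesgue {0..t} (\<lambda>s. complex_mat (memory (t - s)) *v u s)"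
    and "0 < t \<Longrightarrow> vector_derivative u (at t) - (\<integral>y. y \<partial>\<mu>) *\<^sub>R (A_mat *v u t)
      = (LINT s:{0..t}|lebesgue. complex_mat (memory (t - s)) *v u s)"
proof -
  let ?T = "\<lambda>z. complex_mat z *v v"
  interpret T: bounded_linear ?T by (rule bounded_linear_complex_mat_vec)
  show "u 0 = v" by (simp add: u_def char_at_zero complex_mat_1)
  show "continuous_on S u" unfolding u_def by (rule T.continuous_on[OF continuous_on_char])
  have der: "(u has_vector_derivative ?T (\<integral>y. \<i> * complex_of_real y * iexp (t * y) \<partial>\<mu>)) (at t)" for t
    unfolding u_def by (rule T.has_vector_derivative[OF char_has_vector_derivative])
  then show "u differentiable (at t)" by (rule differentiableI_vector)
  assume t: "0 < t"
  have eq: "complex_mat (memory (t - s)) *v u s = ?T (memory (t - s) * char \<mu> s)" for s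
    by (simp add: u_def complex_mat_mult matrix_vector_mul_assoc)
  have cont: "continuous_on {0..t} (\<lambda>s. memory (t - s) * char \<mu> s)"
    by (intro continuous_intros continuous_on_char continuous_on_compose2[OF continuous_on_memory[of UNIV]]) auto
  have int: "integrable lborel (\<lambda>s. indicator {0..t} s *\<^sub>R (memory (t - s) * char \<mu> s))"
    using borel_integrable_atLeastAtMost'[OF cont] by (simp add: set_integrable_def)
  have int_leb: "integrable lebesgue (\<lambda>s. indicator {0..t} s *\<^sub>R (memory (t - s) * char \<mu> s))"
    using int integrable_completion[OF borel_measurable_integrable[OF int]] by simp
  have eq': "indicator {0..t} s *\<^sub>R (complex_mat (memory (t - s)) *v u s)
      = ?T (indicator {0..t} s *\<^sub>R (memory (t - s) * char \<mu> s))" for s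
    unfolding eq by (simp add: T.scaleR)
  show "set_integrable lebesgue {0..t} (\<lambda>s. complex_mat (memory (t - s)) *v u s)"
    unfolding set_integrable_def eq' by (rule integrable_bounded_linear[OF T.bounded_linear_axioms int_leb])
  have "(LINT s:{0..t}|lebesgue. complex_mat (memory (t - s)) *v u s)
      = ?T (LINT s:{0..t}|lebesgue. memory (t - s) * char \<mu> s)"
    unfolding set_lebesgue_integral_def eq' by (rule integral_bounded_linear[OF T.bounded_linear_axioms int_leb])
  also have "(LINT s:{0..t}|lebesgue. memory (t - s) * char \<mu> s) = (LINT s:{0..t}|lborel. memory (t - s) * char \<mu> s)"
    unfolding set_lebesgue_integral_def by (rule integral_completion[OF borel_measurable_integrable[OF int]])
  also have "?T \<dots> = ?T (\<integral>y. \<i> * complex_of_real y * iexp (t * y) \<partial>\<mu>)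
      - (\<integral>y. y \<partial>\<mu>) *\<^sub>R ?T (\<i> * char \<mu> t)"
    unfolding memory_equation[OF less_imp_le[OF t]] T.scaleR[symmetric] T.diff[symmetric]
    by (simp add: scaleR_conv_of_real ac_simps)
  also have "?T (\<i> * char \<mu> t) = A_mat *v u t"
    by (simp add: u_def complex_mat_mult complex_mat_ii matrix_vector_mul_assoc)
  finally show "vector_derivative u (at t) - (\<integral>y. y \<partial>\<mu>) *\<^sub>R (A_mat *v u t)
      = (LINT s:{0..t}|lebesgue. complex_mat (memory (t - s)) *v u s)"
    by (simp add: vector_derivative_at[OF der])
qed

end

section \<open>The Laplace transform\<close>

lemma has_laplace_bounded_linear:
  assumes T: "bounded_linear T" and f: "has_laplace f p L"
  shows "has_laplace (\<lambda>s. T (f s)) p (T L)"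
proof -
  have eq: "indicator {0..} s *\<^sub>R (exp (- p * s) *\<^sub>R T (f s)) = T (indicator {0..} s *\<^sub>R (exp (- p * s) *\<^sub>R f s))" for s
    using T by (simp add: linear_simps)
  have int: "integrable lebesgue (\<lambda>s. indicator {0..} s *\<^sub>R (exp (- p * s) *\<^sub>R f s))"
    using f by (simp add: has_laplace_def set_integrable_def)
  show ?thesis
    unfolding has_laplace_def set_integrable_def set_lebesgue_integral_def eq
    using integrable_bounded_linear[OF T int] integral_bounded_linear[OF T int] f
    by (simp add: has_laplace_def set_lebesgue_integral_def)
qed

text \<open>The positive and the negative part of \<open>h\<close> are densities of two finite measures with the same
  distribution function, hence of the same measure.\<close>

lemma AE_zero_of_cdf_zero:
  fixes h :: "real \<Rightarrow> real"
  assumes h: "integrable lebesgue h" and 0: "\<And>a. (LINT s:{..a}|lebesgue. h s) = 0"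
  shows "AE s in lebesgue. h s = 0"
proof -
  from completion_ex_borel_measurable_real[of h lborel] borel_measurable_integrable[OF h]
  obtain g where g[measurable]: "g \<in> borel_measurable lborel" and gh: "AE s in lborel. h s = g s"
    by auto
  have gh': "AE s in lebesgue. h s = g s" using gh by (rule AE_completion)
  have "integrable lebesgue g"
    by (rule integrable_cong_AE_imp[OF h]) (use gh' g in \<open>auto intro: measurable_completion elim: AE_mp\<close>)
  then have g_int: "integrable lborel g" using integrable_completion[OF g] by blast
  have g0: "(LINT s:{..a}|lborel. g s) = 0" for a
  proof -
    have "(LINT s:{..a}|lborel. g s) = (LINT s:{..a}|lebesgue. g s)"
      unfolding set_lebesgue_integral_def by (subst integral_completion) auto
    also have "\<dots> = (LINT s:{..a}|lebesgue. h s)"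
      unfolding set_lebesgue_integral_def
    proof (rule integral_cong_AE)
      show "AE s in lebesgue. indicat_real {..a} s *\<^sub>R g s = indicat_real {..a} s *\<^sub>R h s"
        using gh' by eventually_elim simp
    qed (use borel_measurable_integrable[OF h] measurable_completion[OF g] in
        \<open>auto intro!: borel_measurable_times borel_measurable_indicator\<close>)
    finally show ?thesis using 0 by simp
  qed
  let ?M = "density lborel (\<lambda>s. ennreal (g s))" and ?N = "density lborel (\<lambda>s. ennreal (- g s))"
  have fin: "(\<integral>\<^sup>+s. ennreal (g s) * indicator A s \<partial>lborel) < \<infinity>" "(\<integral>\<^sup>+s. ennreal (- g s) * indicator A s \<partial>lborel) < \<infinity>"
    for A
  proof -
    have "(\<integral>\<^sup>+s. ennreal (norm (g s)) \<partial>lborel) < \<infinity>" using g_int by (simp add: integrable_iff_bounded)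
    moreover have "(\<integral>\<^sup>+s. ennreal (g s) * indicator A s \<partial>lborel) \<le> (\<integral>\<^sup>+s. ennreal (norm (g s)) \<partial>lborel)"
      "(\<integral>\<^sup>+s. ennreal (- g s) * indicator A s \<partial>lborel) \<le> (\<integral>\<^sup>+s. ennreal (norm (g s)) \<partial>lborel)"
      by (auto intro!: nn_integral_mono ennreal_leI simp: indicator_def)
    ultimately show "(\<integral>\<^sup>+s. ennreal (g s) * indicator A s \<partial>lborel) < \<infinity>"
      "(\<integral>\<^sup>+s. ennreal (- g s) * indicator A s \<partial>lborel) < \<infinity>"
      using le_less_trans by blast+
  qed
  have "?M = ?N"
  proof (rule cdf_unique')
    show "finite_borel_measure ?M" "finite_borel_measure ?N"
      using fin[of UNIV]
      by (auto simp: finite_borel_measure_def finite_borel_measure_axioms_def emeasure_density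
          intro!: finite_measureI)
    show "cdf ?M = cdf ?N"
    proof
      fix a
      have "0 = (\<integral>s. indicator {..a} s * g s \<partial>lborel)"
        using g0[of a] by (simp add: set_lebesgue_integral_def)
      also have "\<dots> = enn2real (\<integral>\<^sup>+s. ennreal (indicator {..a} s * g s) \<partial>lborel)
          - enn2real (\<integral>\<^sup>+s. ennreal (- (indicator {..a} s * g s)) \<partial>lborel)"
        using integrable_mult_indicator[of "{..a}" lborel g] g_int by (intro real_lebesgue_integral_def) auto
      also have "(\<lambda>s. ennreal (indicator {..a} s * g s)) = (\<lambda>s. ennreal (g s) * indicator {..a} s)"
        by (auto simp: indicator_def)
      also have "(\<lambda>s. ennreal (- (indicator {..a} s * g s))) = (\<lambda>s. ennreal (- g s) * indicator {..a} s)"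
        by (auto simp: indicator_def)
      finally show "cdf ?M a = cdf ?N a"
        by (simp add: cdf_def measure_def emeasure_density)
    qed
  qed
  then have "AE s in lborel. ennreal (g s) = ennreal (- g s)"
    by (intro sigma_finite_measure.density_unique[OF sigma_finite_lborel]) auto
  then have "AE s in lborel. h s = 0"
    using gh
  proof eventually_elim
    case (elim s)
    then show ?case by (cases "0 \<le> g s") (auto simp: ennreal_neg)
  qed
  then show ?thesis by (rule AE_completion)
qed

text \<open>Lerch's theorem. With \<open>h s = exp (- s) f s\<close> the transform at \<open>p = n + 1\<close> is the integral of the \<open>n\<close>-th
  power of \<open>exp (- s)\<close> against \<open>h\<close>. As \<open>exp (- s)\<close> stays in the unit interval, polynomials in it can be
  replaced by continuous functions of it, and these by indicators of the intervals \<open>{..a}\<close>.\<close>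

lemma laplace_zero_imp_AE_zero:
  fixes f :: "real \<Rightarrow> real"
  assumes "\<And>p. 0 < p \<Longrightarrow> has_laplace f p 0"
  shows "AE s in lebesgue. 0 \<le> s \<longrightarrow> f s = 0"
proof -
  define h where "h s = indicator {0..} s * (exp (- s) * f s)" for s :: real
  have h: "integrable lebesgue h"
    using assms[of 1] by (simp add: has_laplace_def set_integrable_def h_def[abs_def])
  note [measurable] = borel_measurable_integrable[OF h]
  have exp_meas [measurable]: "(\<lambda>s. exp (- s :: real)) \<in> borel_measurable lebesgue"
    by (rule measurable_completion) measurable
  have bounded_int: "integrable lebesgue (\<lambda>s. g (exp (- s)) * h s)"
    if "g \<in> borel_measurable borel" "\<And>y. 0 \<le> y \<Longrightarrow> y \<le> 1 \<Longrightarrow> \<bar>g y\<bar> \<le> C" for g :: "real \<Rightarrow> real" and C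
  proof (rule Bochner_Integration.integrable_bound[of _ "\<lambda>s. C * h s"])
    show "integrable lebesgue (\<lambda>s. C * h s)" using h by simp
    show "(\<lambda>s. g (exp (- s)) * h s) \<in> borel_measurable lebesgue"
      using measurable_compose[OF exp_meas that(1)] by measurable
    have "norm (g (exp (- s)) * h s) \<le> norm (C * h s)" for s
    proof (cases "0 \<le> s")
      case True
      then have "\<bar>g (exp (- s))\<bar> \<le> \<bar>C\<bar>" using that(2)[of "exp (- s)"] by auto
      then show ?thesis by (simp add: abs_mult mult_right_mono)
    qed (simp add: h_def)
    then show "AE s in lebesgue. norm (g (exp (- s)) * h s) \<le> norm (C * h s)" by simp
  qed
  have mono_int: "integrable lebesgue (\<lambda>s. exp (- s) ^ n * h s)" and mono_zero: "(\<integral>s. exp (- s) ^ n * h s \<partial>lebesgue) = 0" for n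
  proof -
    have eq: "indicator {0..} s *\<^sub>R (exp (- (1 + real n) * s) *\<^sub>R f s) = exp (- s) ^ n * h s" for s
      by (simp add: h_def exp_of_nat_mult[symmetric] exp_add[symmetric] algebra_simps)
    show "integrable lebesgue (\<lambda>s. exp (- s) ^ n * h s)" "(\<integral>s. exp (- s) ^ n * h s \<partial>lebesgue) = 0"
      using assms[of "1 + real n"]
      unfolding has_laplace_def set_integrable_def set_lebesgue_integral_def eq by simp_all
  qed
  have poly_zero: "(\<integral>s. P (exp (- s)) * h s \<partial>lebesgue) = 0"
    if "real_polynomial_function P" for P
  proof -
    from that obtain a n where P: "P = (\<lambda>x. \<Sum>i\<le>n. a i * x ^ i)"
      unfolding real_polynomial_function_iff_sum by auto
    have "(\<integral>s. P (exp (- s)) * h s \<partial>lebesgue) = (\<integral>s. (\<Sum>i\<le>n. a i * (exp (- s) ^ i * h s)) \<partial>lebesgue)"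
      by (simp add: P sum_distrib_right mult.assoc)
    also have "\<dots> = 0"
      using mono_int mono_zero by (subst Bochner_Integration.integral_sum) auto
    finally show ?thesis .
  qed
  have cont_zero: "(\<integral>s. g (exp (- s)) * h s \<partial>lebesgue) = 0"
    if g: "continuous_on UNIV g" for g :: "real \<Rightarrow> real"
  proof -
    have g_meas: "g \<in> borel_measurable borel" using g by (rule borel_measurable_continuous_onI)
    have "compact (g ` {0..1})" using g by (intro compact_continuous_image continuous_on_subset[OF g]) auto
    then obtain C where "\<And>z. z \<in> g ` {0..1} \<Longrightarrow> norm z \<le> C"
      by (elim compact_imp_bounded[THEN bounded_normE]) auto
    then have C: "\<bar>g y\<bar> \<le> C" if "0 \<le> y" "y \<le> 1" for y
      using that by force
    have g_int: "integrable lebesgue (\<lambda>s. g (exp (- s)) * h s)"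
      by (rule bounded_int[OF g_meas C])
    have "\<bar>\<integral>s. g (exp (- s)) * h s \<partial>lebesgue\<bar> \<le> e * (\<integral>s. \<bar>h s\<bar> \<partial>lebesgue)" if e: "0 < e" for e
    proof -
      obtain P where P: "real_polynomial_function P" "\<And>y. y \<in> {0..1} \<Longrightarrow> \<bar>g y - P y\<bar> < e"
        by (rule Stone_Weierstrass_real_polynomial_function
            [OF compact_Icc[of 0 1] continuous_on_subset[OF g subset_UNIV] e]) blast
      have P_int: "integrable lebesgue (\<lambda>s. P (exp (- s)) * h s)"
      proof (rule bounded_int)
        show "P \<in> borel_measurable borel"
          using P(1) by (intro borel_measurable_continuous_onI continuous_at_imp_continuous_on ballI continuous_real_polymonial_function)
        show "\<bar>P y\<bar> \<le> C + e" if "0 \<le> y" "y \<le> 1" for y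
          using C[OF that] P(2)[of y] that by auto
      qed
      have "\<bar>\<integral>s. g (exp (- s)) * h s \<partial>lebesgue\<bar> = \<bar>\<integral>s. g (exp (- s)) * h s - P (exp (- s)) * h s \<partial>lebesgue\<bar>"
        using g_int P_int by (simp add: poly_zero[OF P(1)])
      also have "\<dots> \<le> (\<integral>s. \<bar>g (exp (- s)) * h s - P (exp (- s)) * h s\<bar> \<partial>lebesgue)"
        by (rule integral_abs_bound)
      also have "\<dots> \<le> (\<integral>s. e * \<bar>h s\<bar> \<partial>lebesgue)"
      proof (rule integral_mono)
        show "\<bar>g (exp (- s)) * h s - P (exp (- s)) * h s\<bar> \<le> e * \<bar>h s\<bar>" for s
        proof (cases "0 \<le> s")
          case True
          then have "\<bar>g (exp (- s)) - P (exp (- s))\<bar> \<le> e" using P(2)[of "exp (- s)"] by simp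
          then show ?thesis by (simp add: left_diff_distrib[symmetric] abs_mult mult_right_mono)
        qed (simp add: h_def)
      qed (use g_int P_int h in auto)
      finally show ?thesis by simp
    qed
    note le = this
    have "((\<lambda>e. e * (\<integral>s. \<bar>h s\<bar> \<partial>lebesgue)) \<longlongrightarrow> 0 * (\<integral>s. \<bar>h s\<bar> \<partial>lebesgue)) (at_right 0)"
      by (intro tendsto_intros)
    moreover have "\<forall>\<^sub>F e in at_right 0. \<bar>\<integral>s. g (exp (- s)) * h s \<partial>lebesgue\<bar> \<le> e * (\<integral>s. \<bar>h s\<bar> \<partial>lebesgue)"
      using eventually_at_right_less[of "0::real"] by eventually_elim (rule le)
    ultimately have "\<bar>\<integral>s. g (exp (- s)) * h s \<partial>lebesgue\<bar> \<le> 0 * (\<integral>s. \<bar>h s\<bar> \<partial>lebesgue)"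
      by (rule tendsto_lowerbound) simp
    then show ?thesis by simp
  qed
  have "(LINT s:{..a}|lebesgue. h s) = 0" for a
  proof -
    \<comment> \<open>Continuous functions decreasing to the indicator of y \<ge> exp (- a), that is, of s \<le> a when
      y = exp (- s).\<close>
    define g where "g n y = max 0 (1 - real n * max 0 (exp (- a) - y))" for n and y :: real
    have "(\<lambda>n. \<integral>s. g n (exp (- s)) * h s \<partial>lebesgue) \<longlonglongrightarrow> (\<integral>s. indicator {..a} s *\<^sub>R h s \<partial>lebesgue)"
    proof (rule integral_dominated_convergence[where w = "\<lambda>s. \<bar>h s\<bar>"])
      have [measurable]: "g n \<in> borel_measurable borel" for n
        unfolding g_def[abs_def] by measurable
      show "(\<lambda>s. g n (exp (- s)) * h s) \<in> borel_measurable lebesgue" for n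
        using measurable_compose[OF exp_meas, of "g n"] by measurable
      show "AE s in lebesgue. norm (g n (exp (- s)) * h s) \<le> \<bar>h s\<bar>" for n
        by (auto simp: g_def abs_mult intro!: mult_left_le_one_le AE_I2)
      show "AE s in lebesgue. (\<lambda>n. g n (exp (- s)) * h s) \<longlonglongrightarrow> indicator {..a} s *\<^sub>R h s"
      proof (rule AE_I2)
        fix s
        have "(\<lambda>n. g n (exp (- s))) \<longlonglongrightarrow> indicator {..a} s"
        proof (cases "s \<le> a")
          case True then show ?thesis by (simp add: g_def)
        next
          case False
          then have d: "0 < exp (- a) - exp (- s)" by simp
          have "\<forall>\<^sub>F n in sequentially. 1 / (exp (- a) - exp (- s)) \<le> real n"
            using filterlim_real_sequentially by (simp add: filterlim_at_top)
          then have "\<forall>\<^sub>F n in sequentially. g n (exp (- s)) = 0"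
            by eventually_elim (use d in \<open>simp add: g_def divide_le_eq\<close>)
          then show ?thesis using False by (simp add: tendsto_eventually)
        qed
        then show "(\<lambda>n. g n (exp (- s)) * h s) \<longlonglongrightarrow> indicator {..a} s *\<^sub>R h s"
          by (simp add: tendsto_mult_right)
      qed
    qed (use h borel_measurable_integrable[OF h] in \<open>auto intro!: borel_measurable_times borel_measurable_indicator\<close>)
    moreover have "(\<integral>s. g n (exp (- s)) * h s \<partial>lebesgue) = 0" for n
      unfolding g_def[abs_def] by (rule cont_zero) (intro continuous_intros)
    ultimately have "(\<lambda>n. 0) \<longlonglongrightarrow> (\<integral>s. indicator {..a} s *\<^sub>R h s \<partial>lebesgue)"
      by (simp only:)
    from LIMSEQ_unique[OF this tendsto_const] show ?thesis
      unfolding set_lebesgue_integral_def .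
  qed
  from AE_zero_of_cdf_zero[OF h this] show ?thesis
    by eventually_elim (auto simp: h_def)
qed

lemma laplace_unique_AE:
  fixes f g :: "real \<Rightarrow> 'b::euclidean_space"
  assumes f: "\<And>p. 0 < p \<Longrightarrow> has_laplace f p (L p)" and g: "\<And>p. 0 < p \<Longrightarrow> has_laplace g p (L p)"
  shows "AE s in lebesgue_on {0..}. f s = g s"
proof -
  have "AE s in lebesgue. 0 \<le> s \<longrightarrow> (f s - g s) \<bullet> b = 0" for b
  proof (rule laplace_zero_imp_AE_zero)
    fix p :: real assume p: "0 < p"
    have int: "integrable lebesgue (\<lambda>s. (indicator {0..} s *\<^sub>R exp (- p * s) *\<^sub>R f s) \<bullet> b)"
      "integrable lebesgue (\<lambda>s. (indicator {0..} s *\<^sub>R exp (- p * s) *\<^sub>R g s) \<bullet> b)"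
      using f[OF p] g[OF p] by (auto simp: has_laplace_def set_integrable_def simp del: inner_scaleR_left)
    have eq: "indicator {0..} s *\<^sub>R (exp (- p * s) *\<^sub>R ((f s - g s) \<bullet> b)) =
        (indicator {0..} s *\<^sub>R exp (- p * s) *\<^sub>R f s) \<bullet> b - (indicator {0..} s *\<^sub>R exp (- p * s) *\<^sub>R g s) \<bullet> b" for s
      by (simp add: inner_diff_left algebra_simps)
    have "(\<integral>s. (indicator {0..} s *\<^sub>R exp (- p * s) *\<^sub>R f s) \<bullet> b \<partial>lebesgue) = L p \<bullet> b"
      "(\<integral>s. (indicator {0..} s *\<^sub>R exp (- p * s) *\<^sub>R g s) \<bullet> b \<partial>lebesgue) = L p \<bullet> b"
      using f[OF p] g[OF p]
      by (auto simp: has_laplace_def set_integrable_def set_lebesgue_integral_def simp del: inner_scaleR_left)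
    then show "has_laplace (\<lambda>s. (f s - g s) \<bullet> b) p 0"
      unfolding has_laplace_def set_integrable_def set_lebesgue_integral_def eq using int by simp
  qed
  then have "AE s in lebesgue. \<forall>b\<in>Basis. 0 \<le> s \<longrightarrow> (f s - g s) \<bullet> b = 0"
    by (intro AE_finite_allI) auto
  then have "AE s in lebesgue. 0 \<le> s \<longrightarrow> f s = g s"
  proof eventually_elim
    case (elim s)
    then have "f s \<bullet> b = g s \<bullet> b" if "0 \<le> s" "b \<in> Basis" for b
      using that by (simp add: inner_diff_left)
    then show ?case by (metis euclidean_eqI)
  qed
  then show ?thesis by (subst AE_restrict_space_iff) auto
qed

section \<open>Measurability and Lebesgue measure on products\<close>

text \<open>For the completed measures, measurability of the projections is not just a matter of the product
  structure: it also requires that preimages of null sets are null sets.\<close>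

lemma fst_snd_measurable_lebesgue:
  shows "fst \<in> (lebesgue :: ('a::euclidean_space \<times> 'b::euclidean_space) measure) \<rightarrow>\<^sub>M lebesgue" (is ?fst)
    and "snd \<in> (lebesgue :: ('a \<times> 'b) measure) \<rightarrow>\<^sub>M lebesgue" (is ?snd)
    and "AE x in lebesgue. P x \<Longrightarrow> AE z in (lebesgue :: ('a \<times> 'b) measure). P (fst z)"
    and "AE y in lebesgue. Q y \<Longrightarrow> AE z in (lebesgue :: ('a \<times> 'b) measure). Q (snd z)"
proof -
  have null: "N \<times> UNIV \<in> null_sets (lborel :: ('a \<times> 'b) measure)" if "N \<in> null_sets lborel" for N
    using that lborel.emeasure_pair_measure_Times[of N lborel UNIV]
    unfolding lborel_prod null_sets_def by (auto simp: borel_prod[symmetric])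
  have null': "UNIV \<times> N \<in> null_sets (lborel :: ('a \<times> 'b) measure)" if "N \<in> null_sets lborel" for N
    using that lborel.emeasure_pair_measure_Times[of UNIV lborel N]
    unfolding lborel_prod null_sets_def by (auto simp: borel_prod[symmetric])
  have m: "fst \<in> (lebesgue :: ('a \<times> 'b) measure) \<rightarrow>\<^sub>M lborel" "snd \<in> (lebesgue :: ('a \<times> 'b) measure) \<rightarrow>\<^sub>M lborel"
    by (auto intro!: measurable_completion simp: borel_prod[symmetric])
  show ?fst
  proof (rule completion.measurable_completion2[OF m(1)], rule subsetI)
    fix N :: "'a set" assume N: "N \<in> null_sets lborel"
    have "fst -` N = N \<times> (UNIV :: 'b set)" by auto
    then show "N \<in> null_sets (distr lebesgue lborel (fst :: 'a \<times> 'b \<Rightarrow> 'a))"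
      using null[OF N] N m(1) by (auto simp: null_sets_def emeasure_distr)
  qed
  show ?snd
  proof (rule completion.measurable_completion2[OF m(2)], rule subsetI)
    fix N :: "'b set" assume N: "N \<in> null_sets lborel"
    have "snd -` N = (UNIV :: 'a set) \<times> N" by auto
    then show "N \<in> null_sets (distr lebesgue lborel (snd :: 'a \<times> 'b \<Rightarrow> 'b))"
      using null'[OF N] N m(2) by (auto simp: null_sets_def emeasure_distr)
  qed
  show "AE z in (lebesgue :: ('a \<times> 'b) measure). P (fst z)" if P: "AE x in lebesgue. P x"
  proof -
    obtain N where N: "\<And>x. x \<in> space lborel - N \<Longrightarrow> P x" "N \<in> null_sets lborel"
      using P unfolding AE_completion_iff by (rule AE_E3) blast
    have "x \<in> N" if "\<not> P x" for x using N(1)[of x] that by auto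
    then show ?thesis unfolding AE_completion_iff
      by (intro AE_I'[OF null[OF N(2)]]) auto
  qed
  show "AE z in (lebesgue :: ('a \<times> 'b) measure). Q (snd z)" if Q: "AE y in lebesgue. Q y"
  proof -
    obtain N where N: "\<And>x. x \<in> space lborel - N \<Longrightarrow> Q x" "N \<in> null_sets lborel"
      using Q unfolding AE_completion_iff by (rule AE_E3) blast
    have "x \<in> N" if "\<not> Q x" for x using N(1)[of x] that by auto
    then show ?thesis unfolding AE_completion_iff
      by (intro AE_I'[OF null'[OF N(2)]]) auto
  qed
qed

text \<open>Both sets agree with Borel sets up to null sets, and cylinders over null sets are null sets, so the
  formula for Borel sets carries over.\<close>

lemma emeasure_lebesgue_Times:
  fixes A :: "'a::euclidean_space set" and B :: "'b::euclidean_space set"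
  assumes A: "A \<in> sets lebesgue" and B: "B \<in> sets lebesgue"
  shows "A \<times> B \<in> sets lebesgue" and "emeasure lebesgue (A \<times> B) = emeasure lebesgue A * emeasure lebesgue B"
proof -
  have "A \<times> B = (fst -` A \<inter> space lebesgue) \<inter> (snd -` B \<inter> space lebesgue)" by auto
  then show AB: "A \<times> B \<in> sets lebesgue"
    using measurable_sets[OF fst_snd_measurable_lebesgue(1) A] measurable_sets[OF fst_snd_measurable_lebesgue(2) B]
    by (metis sets.Int)
  let ?A = "main_part lborel A" and ?B = "main_part lborel B"
  have main: "?A \<in> sets lborel" "?B \<in> sets lborel" using main_part_sets[OF A] main_part_sets[OF B] by simp_all
  have "AE x in lebesgue. x \<in> A \<longleftrightarrow> x \<in> ?A" "AE y in lebesgue. y \<in> B \<longleftrightarrow> y \<in> ?B"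
    by (rule AE_mp[OF AE_completion[OF AE_notin_null_part[OF A]]], rule AE_I2,
          use main_part_null_part_Un[OF A] in blast)
       (rule AE_mp[OF AE_completion[OF AE_notin_null_part[OF B]]], rule AE_I2,
          use main_part_null_part_Un[OF B] in blast)
  from fst_snd_measurable_lebesgue(3)[OF this(1)] fst_snd_measurable_lebesgue(4)[OF this(2)]
  have ae: "AE z in lebesgue. z \<in> A \<times> B \<longleftrightarrow> z \<in> ?A \<times> ?B"
    by eventually_elim auto
  have Borel: "?A \<times> ?B \<in> sets lborel"
    using main by (auto simp: borel_prod[symmetric])
  have "emeasure lebesgue (A \<times> B) = emeasure lebesgue (?A \<times> ?B)"
    by (rule emeasure_eq_AE[OF ae AB]) (use Borel in auto)
  also have "\<dots> = emeasure lborel (?A \<times> ?B)"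
    using Borel by simp
  also have "\<dots> = emeasure lborel ?A * emeasure lborel ?B"
    using lborel.emeasure_pair_measure_Times[OF main] by (simp add: lborel_prod)
  also have "\<dots> = emeasure lebesgue A * emeasure lebesgue B"
    using A B by simp
  finally show "emeasure lebesgue (A \<times> B) = emeasure lebesgue A * emeasure lebesgue B" .
qed

lemma sigma_finite_lebesgue_on: "S \<in> sets lebesgue \<Longrightarrow> sigma_finite_measure (lebesgue_on S)"
proof (rule sigma_finite_measure_restrict_space)
  obtain A where A: "countable A" "A \<subseteq> sets (lborel :: 'a measure)" "\<Union>A = space (lborel :: 'a measure)"
    "\<forall>a\<in>A. emeasure (lborel :: 'a measure) a \<noteq> \<infinity>"
    using lborel.sigma_finite_countable by blast
  then show "sigma_finite_measure (lebesgue :: 'a measure)"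
    by unfold_locales (rule exI[of _ A], use A emeasure_completion in \<open>auto simp: subset_iff\<close>)
qed auto

text \<open>Lebesgue measure on a product extends the product of the Lebesgue measures to a larger
  sigma-algebra. Pushing it forward along the identity forgets the additional sets, so integrals of
  functions that are measurable for the product can be computed by Fubini.\<close>

lemma distr_lebesgue_on_Times:
  fixes S :: "'a::euclidean_space set" and T :: "'b::euclidean_space set"
  assumes S: "S \<in> sets lebesgue" and T: "T \<in> sets lebesgue"
  shows measurable_lebesgue_on_Times:
      "(\<lambda>z. z) \<in> lebesgue_on (S \<times> T) \<rightarrow>\<^sub>M lebesgue_on S \<Otimes>\<^sub>M lebesgue_on T" (is ?meas)
    and "distr (lebesgue_on (S \<times> T)) (lebesgue_on S \<Otimes>\<^sub>M lebesgue_on T) (\<lambda>z. z)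
      = lebesgue_on S \<Otimes>\<^sub>M lebesgue_on T" (is ?distr)
proof -
  show m: ?meas
    by (intro measurable_pair measurable_restrict_space3)
      (auto simp: comp_def intro: fst_snd_measurable_lebesgue)
  show ?distr
  proof (rule pair_measure_eqI[symmetric])
    fix A B assume A: "A \<in> sets (lebesgue_on S)" and B: "B \<in> sets (lebesgue_on T)"
    then have AB: "A \<in> sets lebesgue" "A \<subseteq> S" "B \<in> sets lebesgue" "B \<subseteq> T"
      using S T by (auto simp: sets_restrict_space_iff)
    have "emeasure (distr (lebesgue_on (S \<times> T)) (lebesgue_on S \<Otimes>\<^sub>M lebesgue_on T) (\<lambda>z. z)) (A \<times> B)
        = emeasure (lebesgue_on (S \<times> T)) (A \<times> B)"
      using A B AB by (subst emeasure_distr[OF m]) (auto intro!: arg_cong[where f = "emeasure _"])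
    also have "\<dots> = emeasure lebesgue A * emeasure lebesgue B"
      unfolding emeasure_lebesgue_Times(2)[OF AB(1,3), symmetric]
      using AB S T emeasure_lebesgue_Times(1)[OF S T] by (intro emeasure_restrict_space) auto
    also have "\<dots> = emeasure (lebesgue_on S) A * emeasure (lebesgue_on T) B"
      using AB S T by (simp add: emeasure_restrict_space)
    finally show "emeasure (lebesgue_on S) A * emeasure (lebesgue_on T) B
      = emeasure (distr (lebesgue_on (S \<times> T)) (lebesgue_on S \<Otimes>\<^sub>M lebesgue_on T) (\<lambda>z. z)) (A \<times> B)" by simp
  qed (use S T in \<open>auto intro: sigma_finite_lebesgue_on\<close>)
qed

lemma lebesgue_on_ex_borel:
  fixes \<phi> :: "'a::euclidean_space \<Rightarrow> 'b::euclidean_space"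
  assumes S: "S \<in> sets lebesgue" and \<phi>: "\<phi> \<in> borel_measurable (lebesgue_on S)"
  obtains g where "g \<in> borel_measurable borel" "AE x in lebesgue_on S. \<phi> x = g x"
proof -
  let ?f = "\<lambda>x. if x \<in> S then \<phi> x else 0"
  have f: "?f \<in> borel_measurable lebesgue"
    using borel_measurable_if_I[OF \<phi> S] .
  have "\<exists>g. g \<in> borel_measurable borel \<and> (AE x in lborel. ?f x \<bullet> b = g x)" for b
    using completion_ex_borel_measurable_real[of "\<lambda>x. ?f x \<bullet> b" lborel] f
    by (auto intro: borel_measurable_inner)
  then obtain g where g: "\<And>b. g b \<in> borel_measurable borel" "\<And>b. AE x in lborel. ?f x \<bullet> b = g b x"
    by metis
  show thesis
  proof
    show "(\<lambda>x. \<Sum>b\<in>Basis. g b x *\<^sub>R b) \<in> borel_measurable borel"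
      using g(1) by measurable
    have "AE x in lborel. \<forall>b\<in>Basis. ?f x \<bullet> b = g b x"
      using g(2) by (intro AE_finite_allI) auto
    then have "AE x in lebesgue. ?f x = (\<Sum>b\<in>Basis. g b x *\<^sub>R b)"
    proof (intro AE_completion, eventually_elim)
      case (elim x)
      then have "(\<Sum>b\<in>Basis. g b x *\<^sub>R b) = (\<Sum>b\<in>Basis. (?f x \<bullet> b) *\<^sub>R b)"
        by (intro sum.cong) simp_all
      then show ?case by (simp only: euclidean_representation)
    qed
    then show "AE x in lebesgue_on S. \<phi> x = (\<Sum>b\<in>Basis. g b x *\<^sub>R b)"
      using S by (subst AE_restrict_space_iff, simp, elim AE_mp, intro AE_I2) simp
  qed
qed

text \<open>Joint measurability of Caratheodory functions: replacing \<open>t\<close> by the next smaller multiple of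
  \<open>1 / (n + 1)\<close> makes the function piecewise constant in \<open>t\<close> and converges by continuity.\<close>

lemma borel_measurable_Caratheodory:
  fixes f :: "real \<Rightarrow> 'a \<Rightarrow> 'b::{metric_space, second_countable_topology}"
  assumes meas: "\<And>t. f t \<in> borel_measurable M"
    and cont: "\<And>x. x \<in> space M \<Longrightarrow> continuous_on UNIV (\<lambda>t. f t x)"
  shows "(\<lambda>(t, x). f t x) \<in> borel_measurable (borel \<Otimes>\<^sub>M M)"
proof (rule borel_measurable_LIMSEQ_metric)
  define r where "r n t = real_of_int \<lfloor>real (Suc n) * t\<rfloor> / real (Suc n)" for n and t :: real
  show "(\<lambda>z. f (r n (fst z)) (snd z)) \<in> borel_measurable (borel \<Otimes>\<^sub>M M)" for n
  proof -
    have "(\<lambda>z. f (real_of_int i / real (Suc n)) (snd z)) \<in> borel_measurable ((borel :: real measure) \<Otimes>\<^sub>M M)" for i :: int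
      using measurable_compose[OF measurable_snd meas] .
    moreover have "(\<lambda>z. \<lfloor>real (Suc n) * fst z\<rfloor>) \<in> (borel :: real measure) \<Otimes>\<^sub>M M \<rightarrow>\<^sub>M count_space UNIV"
      by measurable
    ultimately show ?thesis
      unfolding r_def
      by (rule measurable_compose_countable[where f = "\<lambda>i z. f (real_of_int i / real (Suc n)) (snd z)"])
  qed
  have r: "(\<lambda>n. r n t) \<longlonglongrightarrow> t" for t
  proof (rule tendsto_sandwich[where h = "\<lambda>_. t" and f = "\<lambda>n. t - inverse (real (Suc n))"])
    have *: "r n t \<le> t" "t - inverse (real (Suc n)) \<le> r n t" for n
    proof -
      have "real_of_int \<lfloor>real (Suc n) * t\<rfloor> \<le> real (Suc n) * t" "real (Suc n) * t - 1 \<le> real_of_int \<lfloor>real (Suc n) * t\<rfloor>"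
        by linarith+
      note this[THEN divide_right_mono, of "real (Suc n)"]
      moreover have "(real (Suc n) * t - 1) / real (Suc n) = t - inverse (real (Suc n))"
        by (simp add: diff_divide_distrib inverse_eq_divide del: of_nat_Suc)
      ultimately show "r n t \<le> t" "t - inverse (real (Suc n)) \<le> r n t"
        unfolding r_def by (simp_all del: of_nat_Suc)
    qed
    then show "\<forall>\<^sub>F n in sequentially. r n t \<le> t" "\<forall>\<^sub>F n in sequentially. t - inverse (real (Suc n)) \<le> r n t"
      by auto
    show "(\<lambda>n. t - inverse (real (Suc n))) \<longlonglongrightarrow> t"
      using tendsto_diff[OF tendsto_const LIMSEQ_inverse_real_of_nat, of t] by simp
  qed simp
  fix z assume "z \<in> space ((borel :: real measure) \<Otimes>\<^sub>M M)"
  then have "snd z \<in> space M" by (auto simp: space_pair_measure)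
  from continuous_on_tendsto_compose[OF cont[OF this] r[of "fst z"]]
  show "(\<lambda>n. f (r n (fst z)) (snd z)) \<longlonglongrightarrow> (case z of (t, x) \<Rightarrow> f t x)"
    by (simp add: case_prod_beta)
qed

section \<open>Weak-star convergence\<close>

lemma integrable_inner_Linfty:
  fixes f \<phi> :: "'a \<Rightarrow> 'b::euclidean_space"
  assumes f: "in_Linfty M f" and \<phi>: "integrable M \<phi>"
  shows "integrable M (\<lambda>x. f x \<bullet> \<phi> x)"
proof -
  obtain C where C: "AE x in M. norm (f x) \<le> C" and [measurable]: "f \<in> borel_measurable M"
    using f unfolding in_Linfty_def by blast
  note [measurable] = borel_measurable_integrable[OF \<phi>]
  show ?thesis
  proof (rule Bochner_Integration.integrable_bound[of _ "\<lambda>x. C * norm (\<phi> x)"])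
    show "AE x in M. norm (f x \<bullet> \<phi> x) \<le> norm (C * norm (\<phi> x))"
      using C
    proof eventually_elim
      case (elim x)
      have "\<bar>f x \<bullet> \<phi> x\<bar> \<le> norm (f x) * norm (\<phi> x)" by (rule Cauchy_Schwarz_ineq2)
      also have "\<dots> \<le> \<bar>C\<bar> * norm (\<phi> x)" using elim by (intro mult_right_mono) auto
      finally show ?case by (simp add: abs_mult)
    qed
  qed (use \<phi> in \<open>auto intro: integrable_norm\<close>)
qed

lemma in_Linfty_add:
  assumes "in_Linfty M f" "in_Linfty M g"
  shows "in_Linfty M (\<lambda>x. f x + g x)"
proof -
  obtain C D where "AE x in M. norm (f x) \<le> C" "AE x in M. norm (g x) \<le> D"
    using assms unfolding in_Linfty_def by blast
  then have "AE x in M. norm (f x + g x) \<le> C + D"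
    by eventually_elim (rule norm_triangle_mono)
  then show ?thesis using assms unfolding in_Linfty_def by auto
qed

lemma in_Linfty_scaleR:
  fixes g :: "'a \<Rightarrow> real"
  assumes "in_Linfty M g" "in_Linfty M v"
  shows "in_Linfty M (\<lambda>x. g x *\<^sub>R v x)"
proof -
  obtain C D where "AE x in M. norm (g x) \<le> C" "AE x in M. norm (v x) \<le> D"
    using assms unfolding in_Linfty_def by blast
  then have "AE x in M. norm (g x *\<^sub>R v x) \<le> C * D"
  proof eventually_elim
    case (elim x)
    then have "norm (g x) * norm (v x) \<le> C * D"
      by (intro mult_mono) (auto intro: order.trans[OF norm_ge_zero])
    then show ?case by simp
  qed
  then show ?thesis using assms unfolding in_Linfty_def by auto
qed

lemma weak_star_Linfty_add:
  assumes "weak_star_Linfty M f f0" "weak_star_Linfty M g g0"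
  shows "weak_star_Linfty M (\<lambda>n x. f n x + g n x) (\<lambda>x. f0 x + g0 x)"
  unfolding weak_star_Linfty_def
proof (intro conjI allI impI)
  show "in_Linfty M (\<lambda>x. f n x + g n x)" "in_Linfty M (\<lambda>x. f0 x + g0 x)" for n
    using assms by (auto simp: weak_star_Linfty_def intro: in_Linfty_add)
  fix \<phi> :: "'a \<Rightarrow> 'b" assume \<phi>: "integrable M \<phi>"
  have int: "integrable M (\<lambda>x. f n x \<bullet> \<phi> x)" "integrable M (\<lambda>x. g n x \<bullet> \<phi> x)"
    "integrable M (\<lambda>x. f0 x \<bullet> \<phi> x)" "integrable M (\<lambda>x. g0 x \<bullet> \<phi> x)" for n
    using assms \<phi> by (auto simp: weak_star_Linfty_def intro: integrable_inner_Linfty)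
  show "(\<lambda>n. \<integral>x. (f n x + g n x) \<bullet> \<phi> x \<partial>M) \<longlonglongrightarrow> (\<integral>x. (f0 x + g0 x) \<bullet> \<phi> x \<partial>M)"
    using assms \<phi> int by (simp add: inner_add_left weak_star_Linfty_def tendsto_add)
qed

lemma weak_star_Linfty_scaleR:
  fixes g :: "nat \<Rightarrow> 'a \<Rightarrow> real"
  assumes g: "weak_star_Linfty M g g0" and v: "in_Linfty M v"
  shows "weak_star_Linfty M (\<lambda>n x. g n x *\<^sub>R v x) (\<lambda>x. g0 x *\<^sub>R v x)"
  unfolding weak_star_Linfty_def
proof (intro conjI allI impI)
  show "in_Linfty M (\<lambda>x. g n x *\<^sub>R v x)" "in_Linfty M (\<lambda>x. g0 x *\<^sub>R v x)" for n
    using g v by (auto simp: weak_star_Linfty_def intro: in_Linfty_scaleR)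
  fix \<phi> :: "'a \<Rightarrow> 'b" assume "integrable M \<phi>"
  then have "integrable M (\<lambda>x. v x \<bullet> \<phi> x)" by (rule integrable_inner_Linfty[OF v])
  then show "(\<lambda>n. \<integral>x. (g n x *\<^sub>R v x) \<bullet> \<phi> x \<partial>M) \<longlonglongrightarrow> (\<integral>x. (g0 x *\<^sub>R v x) \<bullet> \<phi> x \<partial>M)"
    using g by (simp add: weak_star_Linfty_def)
qed

lemma weak_star_Linfty_cong:
  assumes "\<And>n x. x \<in> space M \<Longrightarrow> f n x = f' n x" "\<And>x. x \<in> space M \<Longrightarrow> g x = g' x"
  shows "weak_star_Linfty M f g \<longleftrightarrow> weak_star_Linfty M f' g'"
proof -
  have L: "in_Linfty M h \<longleftrightarrow> in_Linfty M h'" if "\<And>x. x \<in> space M \<Longrightarrow> h x = h' x" for h h' :: "'a \<Rightarrow> 'b"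
    unfolding in_Linfty_def using that measurable_cong[of M h h' borel]
    by (simp cong: AE_cong)
  have I: "(\<integral>x. h x \<bullet> \<phi> x \<partial>M) = (\<integral>x. h' x \<bullet> \<phi> x \<partial>M)" if "\<And>x. x \<in> space M \<Longrightarrow> h x = h' x"
    for h h' \<phi> :: "'a \<Rightarrow> 'b"
    using that by (intro Bochner_Integration.integral_cong) auto
  show ?thesis
    unfolding weak_star_Linfty_def using L[OF assms(1)] L[OF assms(2)] I[OF assms(1)] I[OF assms(2)] by simp
qed

text \<open>The integral against a test function is an iterated integral. The inner integrals converge for each
  \<open>t\<close> by weak-star convergence of the slices, and they are dominated by \<open>C\<close> times the inner integral of
  the norm of the test function, which is integrable in \<open>t\<close>.\<close>

lemma weak_star_Linfty_Times:
  fixes S :: "'a::euclidean_space set" and T :: "'b::euclidean_space set"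
    and f :: "nat \<Rightarrow> 'a \<times> 'b \<Rightarrow> 'c::euclidean_space"
  assumes S: "S \<in> sets lebesgue" and T: "T \<in> sets lebesgue"
    and f_meas: "\<And>n. f n \<in> borel_measurable (lebesgue_on S \<Otimes>\<^sub>M lebesgue_on T)"
    and f0_meas: "f0 \<in> borel_measurable (lebesgue_on S \<Otimes>\<^sub>M lebesgue_on T)"
    and bound: "AE y in lebesgue_on T. \<forall>t\<in>S. (\<forall>n. norm (f n (t, y)) \<le> C) \<and> norm (f0 (t, y)) \<le> C"
    and slices: "\<And>t. t \<in> S \<Longrightarrow> weak_star_Linfty (lebesgue_on T) (\<lambda>n y. f n (t, y)) (\<lambda>y. f0 (t, y))"
  shows "weak_star_Linfty (lebesgue_on (S \<times> T)) f f0"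
proof -
  let ?M1 = "lebesgue_on S" and ?M2 = "lebesgue_on T" and ?M = "lebesgue_on (S \<times> T)"
  note id_meas = distr_lebesgue_on_Times(1)[OF S T] and distr_eq = distr_lebesgue_on_Times(2)[OF S T]
  interpret pair_sigma_finite ?M1 ?M2
    using S T by (simp add: pair_sigma_finite_def sigma_finite_lebesgue_on)
  have bound_pair: "AE z in ?M1 \<Otimes>\<^sub>M ?M2. norm (h z) \<le> C"
    if [measurable]: "h \<in> borel_measurable (?M1 \<Otimes>\<^sub>M ?M2)" and "AE y in ?M2. \<forall>t\<in>S. norm (h (t, y)) \<le> C" for h :: "'a \<times> 'b \<Rightarrow> 'c"
  proof (rule AE_pair_measure)
    show "{z \<in> space (?M1 \<Otimes>\<^sub>M ?M2). norm (h z) \<le> C} \<in> sets (?M1 \<Otimes>\<^sub>M ?M2)" by measurable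
    show "AE t in ?M1. AE y in ?M2. norm (h (t, y)) \<le> C"
      by (rule AE_I2, rule AE_mp[OF that(2)]) simp
  qed
  have bn: "AE z in ?M1 \<Otimes>\<^sub>M ?M2. norm (f n z) \<le> C" for n
    by (rule bound_pair[OF f_meas], rule AE_mp[OF bound]) simp
  have b0: "AE z in ?M1 \<Otimes>\<^sub>M ?M2. norm (f0 z) \<le> C"
    by (rule bound_pair[OF f0_meas], rule AE_mp[OF bound]) simp
  have Linfty_pair: "in_Linfty ?M h"
    if m: "h \<in> borel_measurable (?M1 \<Otimes>\<^sub>M ?M2)" and b: "AE z in ?M1 \<Otimes>\<^sub>M ?M2. norm (h z) \<le> C" for h :: "'a \<times> 'b \<Rightarrow> 'c"
    unfolding in_Linfty_def
    by (intro conjI exI, rule measurable_compose[OF id_meas m],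
        rule AE_distrD[OF id_meas, unfolded distr_eq], rule b)
  show ?thesis
    unfolding weak_star_Linfty_def
  proof (intro conjI allI impI)
    show "in_Linfty ?M (f n)" for n by (rule Linfty_pair[OF f_meas bn])
    show "in_Linfty ?M f0" by (rule Linfty_pair[OF f0_meas b0])
    fix \<phi> :: "'a \<times> 'b \<Rightarrow> 'c" assume \<phi>: "integrable ?M \<phi>"
    \<comment> \<open>The test function is measurable only for the completed measure on the product, which is too
      weak for Fubini; a Borel function that agrees with it almost everywhere does not have this defect.\<close>
    obtain g where g: "g \<in> borel_measurable borel" and \<phi>g: "AE z in ?M. \<phi> z = g z"
      using lebesgue_on_ex_borel[OF emeasure_lebesgue_Times(1)[OF S T] borel_measurable_integrable[OF \<phi>]] by blast
    have 1: "(\<lambda>x. x) \<in> borel_measurable ?M1" and 2: "(\<lambda>x. x) \<in> borel_measurable ?M2"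
      by (auto intro!: measurable_restrict_space1 measurable_completion)
    have "(\<lambda>z. (fst z, snd z)) \<in> ?M1 \<Otimes>\<^sub>M ?M2 \<rightarrow>\<^sub>M borel \<Otimes>\<^sub>M borel"
      by (rule measurable_Pair[OF measurable_compose[OF measurable_fst 1] measurable_compose[OF measurable_snd 2]])
    then have g_meas [measurable]: "g \<in> borel_measurable (?M1 \<Otimes>\<^sub>M ?M2)"
      using g by (auto simp: borel_prod dest: measurable_compose)
    have "integrable ?M g"
      by (rule integrable_cong_AE_imp[OF \<phi> measurable_compose[OF id_meas g_meas]]) (rule \<phi>g)
    then have g_int: "integrable (?M1 \<Otimes>\<^sub>M ?M2) g"
      using integrable_distr_eq[OF id_meas g_meas] distr_eq by simp
    have fub: "(\<integral>z. h z \<bullet> \<phi> z \<partial>?M) = (\<integral>t. (\<integral>y. h (t, y) \<bullet> g (t, y) \<partial>?M2) \<partial>?M1)"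
      "integrable (?M1 \<Otimes>\<^sub>M ?M2) (\<lambda>z. h z \<bullet> g z)"
      if m[measurable]: "h \<in> borel_measurable (?M1 \<Otimes>\<^sub>M ?M2)" and b: "AE z in ?M1 \<Otimes>\<^sub>M ?M2. norm (h z) \<le> C" for h
    proof -
      have L: "in_Linfty (?M1 \<Otimes>\<^sub>M ?M2) h" using m b unfolding in_Linfty_def by (intro conjI exI)
      show int: "integrable (?M1 \<Otimes>\<^sub>M ?M2) (\<lambda>z. h z \<bullet> g z)"
        by (rule integrable_inner_Linfty[OF L g_int])
      have "(\<integral>z. h z \<bullet> \<phi> z \<partial>?M) = (\<integral>z. h z \<bullet> g z \<partial>?M)"
      proof (rule integral_cong_AE)
        show "AE z in ?M. h z \<bullet> \<phi> z = h z \<bullet> g z" using \<phi>g by eventually_elim simp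
      qed (use measurable_compose[OF id_meas m] measurable_compose[OF id_meas g_meas]
            borel_measurable_integrable[OF \<phi>] in \<open>auto intro: borel_measurable_inner\<close>)
      also have "\<dots> = (\<integral>z. h z \<bullet> g z \<partial>(?M1 \<Otimes>\<^sub>M ?M2))"
        using integral_distr[OF id_meas borel_measurable_integrable[OF int]] unfolding distr_eq by simp
      also have "\<dots> = (\<integral>t. (\<integral>y. h (t, y) \<bullet> g (t, y) \<partial>?M2) \<partial>?M1)"
        by (rule integral_fst'[OF int, symmetric])
      finally show "(\<integral>z. h z \<bullet> \<phi> z \<partial>?M) = (\<integral>t. (\<integral>y. h (t, y) \<bullet> g (t, y) \<partial>?M2) \<partial>?M1)" .
    qed
    have gt: "AE t in ?M1. integrable ?M2 (\<lambda>y. g (t, y))" by (rule AE_integrable_fst'[OF g_int])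
    have "(\<lambda>n. \<integral>t. (\<integral>y. f n (t, y) \<bullet> g (t, y) \<partial>?M2) \<partial>?M1) \<longlonglongrightarrow> (\<integral>t. (\<integral>y. f0 (t, y) \<bullet> g (t, y) \<partial>?M2) \<partial>?M1)"
    proof (rule integral_dominated_convergence[where w = "\<lambda>t. \<integral>y. C * norm (g (t, y)) \<partial>?M2"])
      show "(\<lambda>t. \<integral>y. f n (t, y) \<bullet> g (t, y) \<partial>?M2) \<in> borel_measurable ?M1" for n
        using integrable_fst'[OF fub(2)[OF f_meas bn]] by simp
      show "(\<lambda>t. \<integral>y. f0 (t, y) \<bullet> g (t, y) \<partial>?M2) \<in> borel_measurable ?M1"
        using integrable_fst'[OF fub(2)[OF f0_meas b0]] by simp
      show "integrable ?M1 (\<lambda>t. \<integral>y. C * norm (g (t, y)) \<partial>?M2)"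
        using integrable_fst'[of "\<lambda>z. C * norm (g z)"] g_int by simp
      show "AE t in ?M1. (\<lambda>n. \<integral>y. f n (t, y) \<bullet> g (t, y) \<partial>?M2) \<longlonglongrightarrow> (\<integral>y. f0 (t, y) \<bullet> g (t, y) \<partial>?M2)"
        using gt AE_space
        by eventually_elim (use slices in \<open>auto simp: weak_star_Linfty_def\<close>)
      show "AE t in ?M1. norm (\<integral>y. f n (t, y) \<bullet> g (t, y) \<partial>?M2) \<le> (\<integral>y. C * norm (g (t, y)) \<partial>?M2)" for n
        using gt AE_space
      proof eventually_elim
        case (elim t)
        then have t: "t \<in> S" by simp
        have L: "in_Linfty ?M2 (\<lambda>y. f n (t, y))" using slices[OF t] by (simp add: weak_star_Linfty_def)
        have "norm (\<integral>y. f n (t, y) \<bullet> g (t, y) \<partial>?M2) \<le> (\<integral>y. norm (f n (t, y) \<bullet> g (t, y)) \<partial>?M2)"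
          by (rule integral_norm_bound)
        also have "\<dots> \<le> (\<integral>y. C * norm (g (t, y)) \<partial>?M2)"
        proof (rule integral_mono_AE)
          show "AE y in ?M2. norm (f n (t, y) \<bullet> g (t, y)) \<le> C * norm (g (t, y))"
            using bound
          proof eventually_elim
            case (elim y)
            have "norm (f n (t, y) \<bullet> g (t, y)) \<le> norm (f n (t, y)) * norm (g (t, y))"
              by (simp add: Cauchy_Schwarz_ineq2)
            also have "\<dots> \<le> C * norm (g (t, y))" using elim t by (intro mult_right_mono) auto
            finally show ?case .
          qed
        qed (use elim integrable_inner_Linfty[OF L elim(1)] in auto)
        finally show ?case .
      qed
    qed
    then show "(\<lambda>n. \<integral>z. f n z \<bullet> \<phi> z \<partial>?M) \<longlonglongrightarrow> (\<integral>z. f0 z \<bullet> \<phi> z \<partial>?M)"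
      by (simp add: fub(1)[OF f_meas bn] fub(1)[OF f0_meas b0])
  qed
qed

section \<open>The homogenized equation\<close>

lemma set_integral_full_measure:
  fixes f :: "real \<Rightarrow> 'b::{banach, second_countable_topology}"
  assumes "sets M = sets borel" and "emeasure M (- A) = 0" and "A \<in> sets borel" and "f \<in> borel_measurable borel"
  shows "(LINT y:A|M. f y) = (\<integral>y. f y \<partial>M)"
  unfolding set_lebesgue_integral_def
proof (rule integral_cong_AE)
  have "AE y in M. y \<notin> - A"
    using assms by (intro AE_not_in) (auto simp: null_sets_def)
  then show "AE y in M. indicator A y *\<^sub>R f y = f y" by eventually_elim simp
  have [measurable_cong]: "sets M = sets borel" by fact
  note [measurable] = assms(3,4)
  show "(\<lambda>y. indicator A y *\<^sub>R f y) \<in> borel_measurable M" "f \<in> borel_measurable M"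
    by measurable
qed

lemma young_measures_compact_spectrum:
  assumes "young_measures \<Omega> bmin bmax b \<nu>" "x \<in> \<Omega>"
  shows "compact_spectrum (\<nu> x) (max \<bar>bmin\<bar> \<bar>bmax\<bar>)"
    and "f \<in> borel_measurable borel \<Longrightarrow>
      (LINT y:{bmin..bmax}|\<nu> x. f y) = (\<integral>y. (f y :: 'b::{banach, second_countable_topology}) \<partial>\<nu> x)"
proof -
  have \<nu>: "prob_space (\<nu> x)" "sets (\<nu> x) = sets borel" "emeasure (\<nu> x) (- {bmin..bmax}) = 0"
    using assms by (auto simp: young_measures_def)
  interpret prob_space "\<nu> x" by fact
  have "AE y in \<nu> x. y \<notin> - {bmin..bmax}"
    using \<nu> by (intro AE_not_in) (auto simp: null_sets_def)
  then have "AE y in \<nu> x. \<bar>y\<bar> \<le> max \<bar>bmin\<bar> \<bar>bmax\<bar>" by eventually_elim auto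
  then show "compact_spectrum (\<nu> x) (max \<bar>bmin\<bar> \<bar>bmax\<bar>)"
    using \<nu> by unfold_locales auto
  show "f \<in> borel_measurable borel \<Longrightarrow> (LINT y:{bmin..bmax}|\<nu> x. f y) = (\<integral>y. f y \<partial>\<nu> x)"
    using set_integral_full_measure[OF \<nu>(2,3)] by simp
qed

theorem theorem13:
  fixes \<Omega> :: "(real ^ 'd) set"
    and Uin :: "real ^ 'd \<Rightarrow> real ^ 2"
    and b :: "real \<Rightarrow> real ^ 'd \<Rightarrow> real"
    and bmin bmax :: real
    and eps :: "nat \<Rightarrow> real"
    and \<nu> :: "real ^ 'd \<Rightarrow> real measure"
    and U :: "real \<Rightarrow> real \<Rightarrow> real ^ 'd \<Rightarrow> real ^ 2"
  assumes "open \<Omega>" "connected \<Omega>" "\<Omega> \<noteq> {}" "bounded \<Omega>"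
    and "in_Linfty (lebesgue_on \<Omega>) Uin"
    and "\<And>\<epsilon>. \<epsilon> > 0 \<Longrightarrow> b \<epsilon> \<in> borel_measurable (lebesgue_on \<Omega>)"
    and "\<And>\<epsilon> x. \<epsilon> > 0 \<Longrightarrow> x \<in> \<Omega> \<Longrightarrow> bmin \<le> b \<epsilon> x \<and> b \<epsilon> x \<le> bmax"
    and "\<And>n. eps n > 0" "eps \<longlonglongrightarrow> 0"
    and "young_measures \<Omega> bmin bmax (\<lambda>n. b (eps n)) \<nu>"
    and "\<And>\<epsilon>. \<epsilon> > 0 \<Longrightarrow> solves_oscillation \<Omega> (b \<epsilon>) Uin (U \<epsilon>)"
  shows "\<exists>(U0 :: real \<Rightarrow> real ^ 'd \<Rightarrow> real ^ 2) (K :: real ^ 'd \<Rightarrow> real \<Rightarrow> real ^ 2 ^ 2).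
    weak_star_Linfty (lebesgue_on ({0<..} \<times> \<Omega>)) (\<lambda>n (t, x). U (eps n) t x) (\<lambda>(t, x). U0 t x) \<and>
    solves_memory \<Omega> (b_star bmin bmax \<nu>) K Uin U0 \<and>
    (\<forall>x\<in>\<Omega>. \<forall>p>0. invertible (resolvent_mean bmin bmax \<nu> p x)) \<and>
    (\<forall>x\<in>\<Omega>. \<forall>p>0. has_laplace (K x) p (kernel_laplace bmin bmax \<nu> p x)) \<and>
    (\<forall>x\<in>\<Omega>. \<forall>k :: real \<Rightarrow> real ^ 2 ^ 2.
       (\<forall>p>0. has_laplace k p (kernel_laplace bmin bmax \<nu> p x)) \<longrightarrow>
       (AE s in lebesgue_on {0..}. k s = K x s))"
proof -
  note young = assms(10)
  define R where "R = max \<bar>bmin\<bar> \<bar>bmax\<bar>"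
  have spec: "compact_spectrum (\<nu> x) R" if "x \<in> \<Omega>" for x
    unfolding R_def by (rule young_measures_compact_spectrum(1)[OF young that])
  have b_star: "b_star bmin bmax \<nu> x = (\<integral>y. y \<partial>\<nu> x)" if "x \<in> \<Omega>" for x
    unfolding b_star_def by (rule young_measures_compact_spectrum(2)[OF young that]) measurable
  have resolvent: "resolvent_mean bmin bmax \<nu> p x = complex_mat (compact_spectrum.char_laplace (\<nu> x) p)"
    if x: "x \<in> \<Omega>" and p: "0 < p" for x p
  proof -
    interpret compact_spectrum "\<nu> x" R by (rule spec[OF x])
    have T: "complex_mat \<in> borel_measurable borel"
      by (rule borel_measurable_continuous_onI, rule bounded_linear.continuous_on[OF bounded_linear_complex_mat])
        (rule continuous_on_id)
    have "resolvent_mean bmin bmax \<nu> p x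
        = (LINT y:{bmin..bmax}|\<nu> x. complex_mat (inverse (complex_of_real p - \<i> * complex_of_real y)))"
      unfolding resolvent_mean_def resolvent_eq_complex_mat[OF p] ..
    also have "\<dots> = (\<integral>y. complex_mat (inverse (complex_of_real p - \<i> * complex_of_real y)) \<partial>\<nu> x)"
      by (rule young_measures_compact_spectrum(2)[OF young x], rule measurable_compose[OF _ T]) measurable
    also have "\<dots> = complex_mat (char_laplace p)"
      unfolding char_laplace_def
      by (rule integral_bounded_linear[OF bounded_linear_complex_mat integrable_resolvent[OF p]])
    finally show ?thesis .
  qed
  have inv: "invertible (resolvent_mean bmin bmax \<nu> p x)" if x: "x \<in> \<Omega>" and p: "0 < p" for x p
    unfolding resolvent[OF that]
    by (rule complex_mat_inverse(1)[OF compact_spectrum.char_laplace_nonzero[OF spec[OF x] p]])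
  \<comment> \<open>The kernel at x is the memory kernel of the law given by the Young measure at x.\<close>
  define K where "K x t = complex_mat (compact_spectrum.memory (\<nu> x) t)" for x t
  have K: "has_laplace (K x) p (kernel_laplace bmin bmax \<nu> p x)" if x: "x \<in> \<Omega>" and p: "0 < p" for x p
  proof -
    interpret compact_spectrum "\<nu> x" R by (rule spec[OF x])
    have "kernel_laplace bmin bmax \<nu> p x
        = complex_mat (p - \<i> * complex_of_real (\<integral>y. y \<partial>\<nu> x) - inverse (char_laplace p))"
      using complex_mat_inverse(2)[OF char_laplace_nonzero[OF p]]
      by (simp add: kernel_laplace_def B_mat_def resolvent[OF x p] b_star[OF x] complex_mat_def algebra_simps)
    moreover have "has_laplace memory p (p - \<i> * complex_of_real (\<integral>y. y \<partial>\<nu> x) - inverse (char_laplace p))"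
      using laplace_memory[OF p] by (simp add: has_laplace_def)
    ultimately show ?thesis
      unfolding K_def using has_laplace_bounded_linear[OF bounded_linear_complex_mat] by simp
  qed
  define U0 where "U0 t x = complex_mat (char (\<nu> x) t) *v Uin x" for t x
  have mem: "solves_memory \<Omega> (b_star bmin bmax \<nu>) K Uin U0"
    unfolding solves_memory_def
  proof (intro ballI)
    fix x assume x: "x \<in> \<Omega>"
    interpret compact_spectrum "\<nu> x" R by (rule spec[OF x])
    show "U0 0 x = Uin x \<and> continuous_on {0..} (\<lambda>t. U0 t x) \<and>
        (\<forall>t>0. (\<lambda>s. U0 s x) differentiable (at t) \<and>
           set_integrable lebesgue {0..t} (\<lambda>s. K x (t - s) *v U0 s x) \<and>
           vector_derivative (\<lambda>s. U0 s x) (at t) - b_star bmin bmax \<nu> x *\<^sub>R (A_mat *v U0 t x)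
             = (LINT s:{0..t}|lebesgue. K x (t - s) *v U0 s x))"
      unfolding U0_def K_def b_star[OF x] using char_solves_memory[where v = "Uin x"] by blast
  qed
  have weak: "weak_star_Linfty (lebesgue_on ({0<..} \<times> \<Omega>)) (\<lambda>n (t, x). U (eps n) t x) (\<lambda>(t, x). U0 t x)"
  proof -
    have \<Omega>: "\<Omega> \<in> sets lebesgue" using \<open>open \<Omega>\<close> by auto
    let ?L = "lebesgue_on \<Omega>" and ?T = "lebesgue_on {0::real<..}"
    let ?f = "\<lambda>n (t, x). complex_mat (iexp (t * b (eps n) x)) *v Uin x" and ?g = "\<lambda>(t, x). U0 t x"
    have Uin_meas [measurable]: "Uin \<in> borel_measurable ?L"
      using assms(5) by (simp add: in_Linfty_def)
    obtain C where C: "AE x in ?L. norm (Uin x) \<le> C"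
      using assms(5) unfolding in_Linfty_def by blast
    have AUin_meas [measurable]: "(\<lambda>x. A_mat *v Uin x) \<in> borel_measurable ?L"
      by (rule measurable_compose[OF Uin_meas borel_measurable_continuous_onI
            [OF linear_continuous_on[OF matrix_vector_mul_bounded_linear]]])
    have A_norm: "norm (A_mat *v v) = norm v" for v
      using norm_complex_mat_mult_vec[of \<i> v] by (simp add: complex_mat_ii)
    have AUin: "in_Linfty ?L (\<lambda>x. A_mat *v Uin x)"
      using AUin_meas C unfolding in_Linfty_def A_norm by blast
    have char_cos: "Re (char (\<nu> x) t) = (LINT y:{bmin..bmax}|\<nu> x. cos (t * y))"
      and char_sin: "Im (char (\<nu> x) t) = (LINT y:{bmin..bmax}|\<nu> x. sin (t * y))" if x: "x \<in> \<Omega>" for x t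
    proof -
      interpret compact_spectrum "\<nu> x" R by (rule spec[OF x])
      have "Re (char (\<nu> x) t) = (\<integral>y. Re (iexp (t * y)) \<partial>\<nu> x)" "Im (char (\<nu> x) t) = (\<integral>y. Im (iexp (t * y)) \<partial>\<nu> x)"
        unfolding char_def using integrable_iexp(1)[of t] by (simp_all del: Re_exp Im_exp)
      moreover have "(LINT y:{bmin..bmax}|\<nu> x. cos (t * y)) = (\<integral>y. cos (t * y) \<partial>\<nu> x)"
        "(LINT y:{bmin..bmax}|\<nu> x. sin (t * y)) = (\<integral>y. sin (t * y) \<partial>\<nu> x)"
        by (rule young_measures_compact_spectrum(2)[OF young x], measurable)+
      ultimately show "Re (char (\<nu> x) t) = (LINT y:{bmin..bmax}|\<nu> x. cos (t * y))"
        "Im (char (\<nu> x) t) = (LINT y:{bmin..bmax}|\<nu> x. sin (t * y))"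
        by (simp_all add: Re_exp Im_exp)
    qed
    have cosw: "weak_star_Linfty ?L (\<lambda>n x. cos (t * b (eps n) x)) (\<lambda>x. Re (char (\<nu> x) t))"
      and sinw: "weak_star_Linfty ?L (\<lambda>n x. sin (t * b (eps n) x)) (\<lambda>x. Im (char (\<nu> x) t))" for t
    proof -
      have "continuous_on UNIV (\<lambda>y. cos (t * y))" "continuous_on UNIV (\<lambda>y. sin (t * y))"
        by (intro continuous_intros)+
      then have "weak_star_Linfty ?L (\<lambda>n x. cos (t * b (eps n) x)) (\<lambda>x. LINT y:{bmin..bmax}|\<nu> x. cos (t * y))"
        "weak_star_Linfty ?L (\<lambda>n x. sin (t * b (eps n) x)) (\<lambda>x. LINT y:{bmin..bmax}|\<nu> x. sin (t * y))"
        using young unfolding young_measures_def by blast+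
      then show "weak_star_Linfty ?L (\<lambda>n x. cos (t * b (eps n) x)) (\<lambda>x. Re (char (\<nu> x) t))"
        "weak_star_Linfty ?L (\<lambda>n x. sin (t * b (eps n) x)) (\<lambda>x. Im (char (\<nu> x) t))"
        by (subst weak_star_Linfty_cong[OF refl], simp_all add: char_cos char_sin)+
    qed
    have slice: "weak_star_Linfty ?L (\<lambda>n x. ?f n (t, x)) (\<lambda>x. ?g (t, x))" for t
      using weak_star_Linfty_add[OF weak_star_Linfty_scaleR[OF cosw[of t] assms(5)] weak_star_Linfty_scaleR[OF sinw[of t] AUin]]
      by (simp add: U0_def complex_mat_mult_vec Re_exp Im_exp)
    have char_meas: "(\<lambda>x. char (\<nu> x) t) \<in> borel_measurable ?L" for t
      using cosw[of t] sinw[of t] unfolding weak_star_Linfty_def in_Linfty_def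
      by (subst borel_measurable_complex_iff) blast
    have char_pair: "(\<lambda>(t, x). char (\<nu> x) t) \<in> borel_measurable (borel \<Otimes>\<^sub>M ?L)"
      by (rule borel_measurable_Caratheodory[OF char_meas])
        (simp add: compact_spectrum.continuous_on_char[OF spec])
    have time: "(\<lambda>t. t) \<in> borel_measurable ?T"
      by (auto intro!: measurable_restrict_space1 measurable_completion)
    have emb: "(\<lambda>z. (fst z, snd z)) \<in> ?T \<Otimes>\<^sub>M ?L \<rightarrow>\<^sub>M borel \<Otimes>\<^sub>M ?L"
      by (rule measurable_Pair[OF measurable_compose[OF measurable_fst time] measurable_snd])
    have fst_meas [measurable]: "fst \<in> borel_measurable (?T \<Otimes>\<^sub>M ?L)"
      by (rule measurable_compose[OF measurable_fst time])
    have [measurable]: "(\<lambda>z. char (\<nu> (snd z)) (fst z)) \<in> borel_measurable (?T \<Otimes>\<^sub>M ?L)"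
      using measurable_compose[OF emb char_pair] by simp
    have [measurable]: "b (eps n) \<in> borel_measurable ?L" for n
      using assms(6,8) by blast
    have "weak_star_Linfty (lebesgue_on ({0<..} \<times> \<Omega>)) ?f ?g"
    proof (rule weak_star_Linfty_Times[OF _ \<Omega> _ _ _ slice])
      show "?f n \<in> borel_measurable (?T \<Otimes>\<^sub>M ?L)" for n
        unfolding complex_mat_mult_vec case_prod_beta by measurable
      show "?g \<in> borel_measurable (?T \<Otimes>\<^sub>M ?L)"
        unfolding U0_def complex_mat_mult_vec case_prod_beta by measurable
      show "AE x in ?L. \<forall>t\<in>{0<..}. (\<forall>n. norm (?f n (t, x)) \<le> C) \<and> norm (?g (t, x)) \<le> C"
        using C AE_space
      proof eventually_elim
        case (elim x)
        then interpret compact_spectrum "\<nu> x" R by (intro spec) simp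
        have "norm (char (\<nu> x) t) * norm (Uin x) \<le> 1 * C" for t
          using elim(1) by (intro mult_mono norm_char_le_1) auto
        then show ?case using elim(1) by (auto simp: U0_def norm_complex_mat_mult_vec)
      qed
    qed auto
    then show ?thesis
    proof (rule iffD2[OF weak_star_Linfty_cong, rotated 2])
      show "(case z of (t, x) \<Rightarrow> U (eps n) t x) = ?f n z" if "z \<in> space (lebesgue_on ({0<..} \<times> \<Omega>))" for n z
        using that solves_oscillation_unique[OF assms(11)[OF assms(8)[of n]]] by auto
    qed simp
  qed
  have unique: "AE s in lebesgue_on {0..}. k s = K x s"
    if "x \<in> \<Omega>" "\<forall>p>0. has_laplace k p (kernel_laplace bmin bmax \<nu> p x)" for x k
    using that K[OF that(1)] by (intro laplace_unique_AE[where L = "\<lambda>p. kernel_laplace bmin bmax \<nu> p x"]) auto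
  show ?thesis
    using weak mem inv K unique by blast
qed

end
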